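(* Let $m\ge2$, let $H$ be a complex Hilbert space, and let $E$ be a POVM on $\Omega_m=\{0,\dots,m-1\}^{\mathbb N}$ with values in $B(H)$. Then $E$ is extreme in the convex set $\mathcal P(\Omega_m,H)$ of POVMs on $\Omega_m$ with values in $B(H)$ if and only if the only bounded range martingale $\{X_w\}$ for $E$ satisfying $X_\varnothing=0$ is the zero family.
   Context: $\Omega_m$ carries its product Borel $\sigma$-algebra $\mathcal B(\Omega_m)$. For a finite word $w=w_1\cdots w_n$ in $\{0,\dots,m-1\}$, $[w]=\{x\in\Omega_m:x_1=w_1,\dots,x_n=w_n\}$; the empty word is $\varnothing$, and $[\varnothing]=\Omega_m$; $wj$ is $w$ with the letter $j$ appended. A POVM on $\Omega_m$ with values in $B(H)$ is a map $E:\mathcal B(\Omega_m)\to B(H)_+$ that is countably additive in the weak operator topology and satisfies $E(\Omega_m)=I$. $E$ is extreme in $\mathcal P(\Omega_m,H)$ if whenever $E=\frac12(E_1+E_2)$ with $E_1,E_2\in\mathcal P(\Omega_m,H)$, it follows that $E_1=E_2=E$. Put $E_w=E([w])$ and $H_w=\overline{\operatorname{ran}}(E_w^{1/2})$. For $0\le j\le m-1$, the edge contraction $C_{wj}:H_w\to H_{wj}$ is the unique contraction with $C_{wj}E_w^{1/2}h=E_{wj}^{1/2}h$ for all $h\in H$. A bounded range martingale for $E$ is a family of self-adjoint operators $X_w\in B(H_w)$, indexed by all finite words $w$, such that $\sup_w\|X_w\|<\infty$ and $X_w=\sum_{j=0}^{m-1}C_{wj}^*X_{wj}C_{wj}$ for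 every finite word $w$. *)

theory Defs
  imports "HOL-Analysis.Analysis"
begin

text \<open>Complex Hilbert spaces. The inner product is conjugate-linear in its first argument.\<close>

class complex_hilbert_space = banach +
  fixes scaleC :: "complex \<Rightarrow> 'a \<Rightarrow> 'a" (infixr "*\<^sub>C" 75)
    and cinner :: "'a \<Rightarrow> 'a \<Rightarrow> complex"
  assumes scaleR_scaleC: "r *\<^sub>R x = complex_of_real r *\<^sub>C x"
    and scaleC_add_right: "c *\<^sub>C (x + y) = c *\<^sub>C x + c *\<^sub>C y"
    and scaleC_add_left: "(c + d) *\<^sub>C x = c *\<^sub>C x + d *\<^sub>C x"
    and scaleC_scaleC: "c *\<^sub>C (d *\<^sub>C x) = (c * d) *\<^sub>C x"
    and scaleC_one: "1 *\<^sub>C x = x"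
    and cinner_commute: "cinner x y = cnj (cinner y x)"
    and cinner_add_left: "cinner (x + y) z = cinner x z + cinner y z"
    and cinner_scaleC_left: "cinner (c *\<^sub>C x) y = cnj c * cinner x y"
    and cinner_self_nonneg: "cinner x x \<in> \<real>\<^sub>\<ge>\<^sub>0"
    and cinner_self_eq_zero_iff: "cinner x x = 0 \<longleftrightarrow> x = 0"
    and norm_eq_sqrt_cinner: "norm x = sqrt (Re (cinner x x))"

text \<open>
  An operator between closed subspaces \<open>S\<close> and \<open>T\<close> is a function on the ambient type of
  which only the values on \<open>S\<close> matter. The operators in \<open>B(H)\<close> are the case
  \<open>S = T = UNIV\<close>.
\<close>

definition bounded_clinear_on ::
  "'a::complex_hilbert_space set \<Rightarrow> 'b::complex_hilbert_space set \<Rightarrow> ('a \<Rightarrow> 'b) \<Rightarrow> bool" where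
  "bounded_clinear_on S T A \<longleftrightarrow>
     A \<in> S \<rightarrow> T \<and>
     (\<forall>x\<in>S. \<forall>y\<in>S. A (x + y) = A x + A y) \<and>
     (\<forall>c. \<forall>x\<in>S. A (c *\<^sub>C x) = c *\<^sub>C A x) \<and>
     (\<exists>K. \<forall>x\<in>S. norm (A x) \<le> K * norm x)"

text \<open>The analogue of \<^const>\<open>onorm\<close> on \<open>S\<close>; the point \<open>x = 0\<close> contributes \<open>0 / 0 = 0\<close>.\<close>

definition onorm_on ::
  "'a::complex_hilbert_space set \<Rightarrow> ('a \<Rightarrow> 'b::complex_hilbert_space) \<Rightarrow> real" where
  "onorm_on S A = (SUP x\<in>S. norm (A x) / norm x)"

definition adjoint_on ::
  "'a::complex_hilbert_space set \<Rightarrow> 'b::complex_hilbert_space set \<Rightarrow> ('a \<Rightarrow> 'b) \<Rightarrow> 'b \<Rightarrow> 'a" where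
  "adjoint_on S T A = (\<lambda>y\<in>T. THE z. z \<in> S \<and> (\<forall>x\<in>S. cinner z x = cinner y (A x)))"

definition selfadjoint_on ::
  "'a::complex_hilbert_space set \<Rightarrow> ('a \<Rightarrow> 'a) \<Rightarrow> bool" where
  "selfadjoint_on S A \<longleftrightarrow>
     bounded_clinear_on S S A \<and> (\<forall>x\<in>S. \<forall>y\<in>S. cinner (A x) y = cinner x (A y))"

definition positive_op :: "('a::complex_hilbert_space \<Rightarrow> 'a) \<Rightarrow> bool" where
  "positive_op A \<longleftrightarrow> bounded_clinear_on UNIV UNIV A \<and> (\<forall>x. cinner x (A x) \<in> \<real>\<^sub>\<ge>\<^sub>0)"

definition sqrt_op :: "('a::complex_hilbert_space \<Rightarrow> 'a) \<Rightarrow> 'a \<Rightarrow> 'a" where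
  "sqrt_op A = (THE B. positive_op B \<and> B \<circ> B = A)"

text \<open>
  The values of a POVM outside the \<open>\<sigma>\<close>-algebra are irrelevant, so the equality
  of POVMs is equality on measurable sets.
\<close>

definition POVMs :: "'x measure \<Rightarrow> ('x set \<Rightarrow> 'a::complex_hilbert_space \<Rightarrow> 'a) set" where
  "POVMs M = {E.
     (\<forall>A\<in>sets M. positive_op (E A)) \<and>
     (\<forall>A. range A \<subseteq> sets M \<and> disjoint_family A \<longrightarrow>
        (\<forall>x y. (\<lambda>n::nat. cinner x (E (A n) y)) sums cinner x (E (\<Union>n. A n) y))) \<and>
     E (space M) = id}"

definition extreme_POVM ::
  "'x measure \<Rightarrow> ('x set \<Rightarrow> 'a::complex_hilbert_space \<Rightarrow> 'a) \<Rightarrow> bool" where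
  "extreme_POVM M E \<longleftrightarrow>
     E \<in> POVMs M \<and>
     (\<forall>E1\<in>POVMs M. \<forall>E2\<in>POVMs M.
        (\<forall>A\<in>sets M. \<forall>x. E A x = (1/2) *\<^sub>R (E1 A x + E2 A x)) \<longrightarrow>
        (\<forall>A\<in>sets M. E1 A = E A \<and> E2 A = E A))"

text \<open>
  Sequences are indexed from \<open>0\<close>, so the letter \<open>x\<^sub>1\<close> is \<open>x 0\<close>; finite words are the elements
  of \<^term>\<open>lists {..<m}\<close>, and \<open>wj\<close> is \<^term>\<open>w @ [j]\<close>.
\<close>

definition Omega :: "nat \<Rightarrow> (nat \<Rightarrow> nat) measure" where
  "Omega m = PiM UNIV (\<lambda>_. count_space {..<m})"

definition cylinder :: "nat \<Rightarrow> nat list \<Rightarrow> (nat \<Rightarrow> nat) set" where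
  "cylinder m w = {x \<in> space (Omega m). \<forall>i<length w. x i = w ! i}"

definition sqrt_cyl ::
  "nat \<Rightarrow> ((nat \<Rightarrow> nat) set \<Rightarrow> 'a::complex_hilbert_space \<Rightarrow> 'a) \<Rightarrow> nat list \<Rightarrow> 'a \<Rightarrow> 'a" where
  "sqrt_cyl m E w = sqrt_op (E (cylinder m w))"

definition range_space ::
  "nat \<Rightarrow> ((nat \<Rightarrow> nat) set \<Rightarrow> 'a::complex_hilbert_space \<Rightarrow> 'a) \<Rightarrow> nat list \<Rightarrow> 'a set" where
  "range_space m E w = closure (range (sqrt_cyl m E w))"

text \<open>Extensionality fixes the irrelevant values outside the domain, so that the description is
  unique.\<close>

definition edge_contraction ::
  "nat \<Rightarrow> ((nat \<Rightarrow> nat) set \<Rightarrow> 'a::complex_hilbert_space \<Rightarrow> 'a) \<Rightarrow> nat list \<Rightarrow> nat \<Rightarrow> 'a \<Rightarrow> 'a" where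
  "edge_contraction m E w j = (THE C.
     C \<in> extensional (range_space m E w) \<and>
     bounded_clinear_on (range_space m E w) (range_space m E (w @ [j])) C \<and>
     (\<forall>x\<in>range_space m E w. norm (C x) \<le> norm x) \<and>
     (\<forall>h. C (sqrt_cyl m E w h) = sqrt_cyl m E (w @ [j]) h))"

definition bounded_range_martingale ::
  "nat \<Rightarrow> ((nat \<Rightarrow> nat) set \<Rightarrow> 'a::complex_hilbert_space \<Rightarrow> 'a) \<Rightarrow> (nat list \<Rightarrow> 'a \<Rightarrow> 'a) \<Rightarrow> bool" where
  "bounded_range_martingale m E X \<longleftrightarrow>
     (\<forall>w\<in>lists {..<m}. selfadjoint_on (range_space m E w) (X w)) \<and>
     bdd_above ((\<lambda>w. onorm_on (range_space m E w) (X w)) ` lists {..<m}) \<and>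
     (\<forall>w\<in>lists {..<m}. \<forall>x\<in>range_space m E w.
        X w x = (\<Sum>j<m. adjoint_on (range_space m E w) (range_space m E (w @ [j]))
                          (edge_contraction m E w j)
                          (X (w @ [j]) (edge_contraction m E w j x))))"

end

theory Submission
  imports Defs
begin

text \<open>
  Write \<open>S\<^sub>w = E\<^sub>w\<^sup>1\<^sup>/\<^sup>2\<close>. The map \<open>X\<^sub>w \<mapsto> F\<^sub>w = S\<^sub>w X\<^sub>w S\<^sub>w\<close> is a bijection between the bounded range
  martingales and the families of self-adjoint operators \<open>F\<^sub>w\<close> that are additive,
  \<open>F\<^sub>w = \<Sum>\<^sub>j F\<^sub>w\<^sub>j\<close>, and satisfy \<open>- c E\<^sub>w \<le> F\<^sub>w \<le> c E\<^sub>w\<close> for some \<open>c\<close>: the relation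
  \<open>C\<^sub>w\<^sub>j S\<^sub>w = S\<^sub>w\<^sub>j\<close> turns the martingale identity into additivity, and an operator dominated by \<open>E\<^sub>w\<close>
  factors through \<open>S\<^sub>w\<close> on both sides (lemma \<open>compression_exists\<close>).

  Suppose that \<open>X\<close> is a bounded martingale with \<open>X\<^sub>\<emptyset> = 0\<close>, scaled such that \<open>- E\<^sub>w \<le> F\<^sub>w \<le> E\<^sub>w\<close>. Domination
  by the countably additive \<open>E\<close> makes \<open>F\<close> the restriction to cylinders of an operator-valued
  measure \<open>T\<close> with \<open>- E \<le> T \<le> E\<close> and total mass \<open>0\<close> (lemmas \<open>signed_measure_extension\<close> and
  \<open>operator_measure_extension\<close>). Then \<open>E + T\<close> and \<open>E - T\<close> are POVMs with mean \<open>E\<close>. If \<open>E\<close> is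
  extreme, then \<open>T = 0\<close>, hence \<open>F = 0\<close>, and \<open>X = 0\<close> because the range of \<open>S\<^sub>w\<close> is dense in
  \<open>H\<^sub>w\<close>.

  Conversely, if \<open>E = (E\<^sub>1 + E\<^sub>2) / 2\<close>, then \<open>0 \<le> E\<^sub>1 \<le> 2 E\<close>, so the restriction of \<open>E\<^sub>1 - E\<close> to
  cylinders comes from a bounded martingale that vanishes at the empty word. If this martingale is
  zero, then \<open>E\<^sub>1\<close> and \<open>E\<close> agree on cylinders, and hence on all Borel sets.

  The operator theory behind this is developed for the class of complex Hilbert spaces: a Riesz
  theorem for functionals bounded by a seminorm \<open>\<parallel>S h\<parallel>\<close> (\<open>Riesz_seminorm\<close>), extension of
  operators from a range to its closure (\<open>factor_through_range\<close>), and existence and uniqueness of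
  the square root of a positive contraction by the binomial series (\<open>sqrt_op\<close>).
\<close>

section \<open>Inner products and forms\<close>

text \<open>Bounded complex-linear operators defined on the whole space.\<close>

abbreviation bounded_clinear :: "('a::complex_hilbert_space \<Rightarrow> 'b::complex_hilbert_space) \<Rightarrow> bool" where
  "bounded_clinear A \<equiv> bounded_clinear_on UNIV UNIV A"

lemma scaleC_zero_left [simp]: "0 *\<^sub>C x = 0"
  using scaleR_scaleC[of 0 x] by simp

lemma scaleC_zero_right [simp]: "c *\<^sub>C 0 = 0"
  using scaleC_add_right[of c 0 0] by simp

lemma scaleC_minus1: "(-1) *\<^sub>C x = - x"
  using scaleR_scaleC[of "-1" x] by simp

lemma scaleC_minus_right: "c *\<^sub>C (- x) = - (c *\<^sub>C x)"
  using scaleC_add_right[of c x "-x"] by (simp add: eq_neg_iff_add_eq_0 add.commute)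

lemma scaleC_diff_right: "c *\<^sub>C (x - y) = c *\<^sub>C x - c *\<^sub>C y"
  using scaleC_add_right[of c x "-y"] by (simp add: scaleC_minus_right)

lemma cinner_add_right: "cinner x (y + z) = cinner x y + cinner x z"
  by (metis cinner_add_left cinner_commute complex_cnj_add)

lemma cinner_scaleC_right: "cinner x (c *\<^sub>C y) = c * cinner x y"
  by (metis cinner_commute cinner_scaleC_left complex_cnj_cnj complex_cnj_mult)

lemma cinner_scaleR_left: "cinner (r *\<^sub>R x) y = of_real r * cinner x y"
  by (simp add: scaleR_scaleC cinner_scaleC_left)

lemma cinner_scaleR_right: "cinner x (r *\<^sub>R y) = of_real r * cinner x y"
  by (simp add: scaleR_scaleC cinner_scaleC_right)

lemma cinner_self: "cinner x x = complex_of_real ((norm x)\<^sup>2)"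
proof -
  from cinner_self_nonneg[of x] obtain r where r: "cinner x x = of_real r" "r \<ge> 0"
    by (auto elim: nonneg_Reals_cases)
  then show ?thesis by (simp add: norm_eq_sqrt_cinner)
qed

lemma norm_scaleC: "norm (c *\<^sub>C x) = cmod c * norm x"
proof -
  have "complex_of_real ((norm (c *\<^sub>C x))\<^sup>2) = cnj c * (c * cinner x x)"
    unfolding cinner_self[symmetric] by (simp add: cinner_scaleC_left cinner_scaleC_right)
  also have "\<dots> = complex_of_real ((cmod c * norm x)\<^sup>2)"
    by (simp add: cinner_self power_mult_distrib complex_norm_square del: of_real_power)
  finally have "(norm (c *\<^sub>C x))\<^sup>2 = (cmod c * norm x)\<^sup>2"
    using of_real_eq_iff by blast
  then show ?thesis by (simp add: power2_eq_iff_nonneg)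
qed

text \<open>A form that is additive and homogeneous in the usual (conjugate-linear, linear) way and
  nonnegative on the diagonal is Hermitian and satisfies the Cauchy--Schwarz inequality. It is
  applied to \<open>(x, y) \<mapsto> \<langle>x, A y\<rangle>\<close> for positive \<open>A\<close>.\<close>

lemma form_hermitian:
  fixes q :: "'a::complex_hilbert_space \<Rightarrow> 'a \<Rightarrow> complex"
  assumes al: "\<And>x y z. q (x + y) z = q x z + q y z" and ar: "\<And>x y z. q x (y + z) = q x y + q x z"
    and sl: "\<And>c x y. q (c *\<^sub>C x) y = cnj c * q x y" and sr: "\<And>c x y. q x (c *\<^sub>C y) = c * q x y"
    and real: "\<And>x. q x x \<in> \<real>"
  shows "q y x = cnj (q x y)"
proof -
  have r: "Im (q x x) = 0" for x using real[of x] by (simp add: complex_is_Real_iff)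
  have 1: "Im (q (x + y) (x + y)) = 0" and 2: "Im (q (x + \<i> *\<^sub>C y) (x + \<i> *\<^sub>C y)) = 0"
    by (rule r)+
  from 1 have "Im (q x y) + Im (q y x) = 0" using r[of x] r[of y] by (simp add: al ar)
  moreover from 2 have "Re (q x y) - Re (q y x) = 0"
    using r[of x] r[of y] by (simp add: al ar sl sr)
  ultimately show ?thesis by (simp add: complex_eq_iff)
qed

lemma form_Cauchy_Schwarz:
  fixes q :: "'a::complex_hilbert_space \<Rightarrow> 'a \<Rightarrow> complex"
  assumes al: "\<And>x y z. q (x + y) z = q x z + q y z" and ar: "\<And>x y z. q x (y + z) = q x y + q x z"
    and sl: "\<And>c x y. q (c *\<^sub>C x) y = cnj c * q x y" and sr: "\<And>c x y. q x (c *\<^sub>C y) = c * q x y"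
    and pos: "\<And>x. q x x \<in> \<real>\<^sub>\<ge>\<^sub>0"
  shows "(cmod (q x y))\<^sup>2 \<le> Re (q x x) * Re (q y y)"
proof -
  have herm: "q v u = cnj (q u v)" for u v
    by (rule form_hermitian) (use assms nonneg_Reals_subset_Reals in auto)
  have p: "Re (q u u) \<ge> 0" for u
    using pos[of u] by (auto simp: complex_nonneg_Reals_iff)
  define b where "b = (cmod (q x y))\<^sup>2"
  have quad: "0 \<le> Re (q x x) - 2 * t * b + t\<^sup>2 * b * Re (q y y)" for t
  proof -
    \<comment> \<open>With this \<open>c\<close> the form at \<open>x + c y\<close> is a quadratic polynomial in \<open>t\<close> with real coefficients.\<close>
    define c where "c = - of_real t * cnj (q x y)"
    have qq: "q x y * cnj (q x y) = of_real b"
      by (simp only: b_def complex_norm_square[symmetric])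
    have "q (x + c *\<^sub>C y) (x + c *\<^sub>C y) = q x x + c * q x y + cnj (c * q x y) + c * cnj c * q y y"
      by (simp add: al ar sl sr herm[of y x] algebra_simps)
    also have "c * q x y = of_real (- t * b)"
      using qq by (simp add: c_def mult_ac)
    also have "c * cnj c = of_real (t\<^sup>2 * b)"
      using qq by (simp add: c_def power2_eq_square mult_ac)
    finally have "Re (q (x + c *\<^sub>C y) (x + c *\<^sub>C y)) = Re (q x x) - 2 * t * b + t\<^sup>2 * b * Re (q y y)"
      by simp
    with p show ?thesis by metis
  qed
  show ?thesis
  proof (cases "Re (q y y) = 0")
    case True
    have "b = 0"
    proof (rule ccontr)
      assume "b \<noteq> 0"
      then show False using quad[of "(Re (q x x) + 1) / b"] p[of x] True by simp
    qed
    then show ?thesis using True b_def by simp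
  next
    case False
    then have qy: "Re (q y y) > 0" using p[of y] by simp
    from quad[of "1 / Re (q y y)"] have "0 \<le> Re (q x x) - b / Re (q y y)"
      using qy by (simp add: field_simps power2_eq_square)
    then show ?thesis using qy by (simp add: b_def field_simps)
  qed
qed

lemma Cauchy_Schwarz: "cmod (cinner x y) \<le> norm x * norm y"
proof -
  have "(cmod (cinner x y))\<^sup>2 \<le> Re (cinner x x) * Re (cinner y y)"
    by (rule form_Cauchy_Schwarz)
      (simp_all add: cinner_add_left cinner_add_right cinner_scaleC_left cinner_scaleC_right
        cinner_self_nonneg)
  also have "\<dots> = (norm x * norm y)\<^sup>2" by (simp add: cinner_self power_mult_distrib)
  finally show ?thesis by (rule power2_le_imp_le) simp
qed

interpretation cinner: bounded_bilinear "cinner :: 'a::complex_hilbert_space \<Rightarrow> 'a \<Rightarrow> complex"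
  by (rule bounded_bilinear.intro)
    (auto simp: cinner_add_left cinner_add_right cinner_scaleR_left cinner_scaleR_right
      scaleR_conv_of_real intro!: exI[of _ 1] Cauchy_Schwarz)

lemma bounded_linear_scaleC: "bounded_linear (scaleC c :: 'a::complex_hilbert_space \<Rightarrow> 'a)"
  by (rule bounded_linear_intro[of _ "cmod c"])
    (simp_all add: scaleC_add_right scaleR_scaleC scaleC_scaleC mult.commute norm_scaleC)

lemma cinner_eqI: "(\<And>y. cinner x y = cinner x' y) \<Longrightarrow> x = x'"
proof -
  assume *: "\<And>y. cinner x y = cinner x' y"
  have "cinner (x - x') (x - x') = 0" by (simp add: cinner.diff_left *)
  then show ?thesis by (simp add: cinner_self_eq_zero_iff)
qed

lemma norm_diff_sq: "(norm (x - y))\<^sup>2 = (norm x)\<^sup>2 + (norm y)\<^sup>2 - 2 * Re (cinner x y)"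
  and norm_add_sq: "(norm (x + y))\<^sup>2 = (norm x)\<^sup>2 + (norm y)\<^sup>2 + 2 * Re (cinner x y)"
proof -
  have n: "(norm u)\<^sup>2 = Re (cinner u u)" for u :: 'a by (simp add: cinner_self)
  have "Re (cinner y x) = Re (cinner x y)" by (subst cinner_commute) simp
  then show "(norm (x - y))\<^sup>2 = (norm x)\<^sup>2 + (norm y)\<^sup>2 - 2 * Re (cinner x y)"
    "(norm (x + y))\<^sup>2 = (norm x)\<^sup>2 + (norm y)\<^sup>2 + 2 * Re (cinner x y)"
    unfolding n by (simp_all add: cinner.diff_left cinner.diff_right cinner_add_left cinner_add_right)
qed

section \<open>Bounded operators and polarization\<close>

lemma bounded_clinear_onD:
  assumes "bounded_clinear_on S T A"
  shows "x \<in> S \<Longrightarrow> A x \<in> T" "x \<in> S \<Longrightarrow> y \<in> S \<Longrightarrow> A (x + y) = A x + A y"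
    "x \<in> S \<Longrightarrow> A (c *\<^sub>C x) = c *\<^sub>C A x"
  using assms by (auto simp: bounded_clinear_on_def)

lemma bounded_clinear_imp_bounded_linear:
  assumes "bounded_clinear A" shows "bounded_linear A"
proof -
  obtain K where "\<And>x. norm (A x) \<le> K * norm x"
    using assms by (auto simp: bounded_clinear_on_def)
  then show ?thesis
    by (intro bounded_linear_intro[of _ K])
      (use assms in \<open>auto simp: bounded_clinear_on_def scaleR_scaleC mult.commute\<close>)
qed

lemma bounded_clinearI:
  assumes "bounded_linear A" "\<And>c x. A (c *\<^sub>C x) = c *\<^sub>C A x"
  shows "bounded_clinear A"
proof -
  interpret bounded_linear A by fact
  show ?thesis
    using nonneg_bounded by (auto simp: bounded_clinear_on_def add assms(2) mult.commute)
qed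

lemma bounded_clinear_scaleC: "bounded_clinear A \<Longrightarrow> A (c *\<^sub>C x) = c *\<^sub>C A x"
  by (rule bounded_clinear_onD) auto

lemma bounded_clinear_zero: "bounded_clinear (\<lambda>x. 0)"
  by (rule bounded_clinearI) auto

lemma bounded_clinear_add:
  "bounded_clinear A \<Longrightarrow> bounded_clinear B \<Longrightarrow> bounded_clinear (\<lambda>x. A x + B x)"
  by (rule bounded_clinearI)
    (auto intro: bounded_linear_add bounded_clinear_imp_bounded_linear
      simp: bounded_clinear_scaleC scaleC_add_right)

lemma bounded_clinear_diff:
  "bounded_clinear A \<Longrightarrow> bounded_clinear B \<Longrightarrow> bounded_clinear (\<lambda>x. A x - B x)"
  by (rule bounded_clinearI)
    (auto intro: bounded_linear_sub bounded_clinear_imp_bounded_linear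
      simp: bounded_clinear_scaleC scaleC_diff_right)

lemma bounded_clinear_sum:
  "(\<And>i. i \<in> I \<Longrightarrow> bounded_clinear (A i)) \<Longrightarrow> bounded_clinear (\<lambda>x. \<Sum>i\<in>I. A i x)"
  by (induction I rule: infinite_finite_induct)
    (auto intro: bounded_clinear_zero bounded_clinear_add)

lemma bounded_clinear_id: "bounded_clinear (\<lambda>x. x)"
  by (rule bounded_clinearI) (auto intro: bounded_linear_ident)

lemma bounded_clinear_scaleR:
  "bounded_clinear A \<Longrightarrow> bounded_clinear (\<lambda>x. r *\<^sub>R A x)"
  by (rule bounded_clinearI, rule bounded_linear_const_scaleR[OF bounded_clinear_imp_bounded_linear])
    (simp_all add: bounded_clinear_scaleC scaleR_scaleC scaleC_scaleC mult.commute)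

text \<open>An operator is determined by its quadratic form, because the scalars are complex.\<close>

lemma polarization:
  assumes "bounded_clinear A"
  shows "cinner x (A y) =
    (cinner (x + y) (A (x + y)) - cinner (x - y) (A (x - y))
     - \<i> * cinner (x + \<i> *\<^sub>C y) (A (x + \<i> *\<^sub>C y)) + \<i> * cinner (x - \<i> *\<^sub>C y) (A (x - \<i> *\<^sub>C y))) / 4"
proof -
  interpret bounded_linear A by (rule bounded_clinear_imp_bounded_linear) fact
  define q where "q u v = cinner u (A v)" for u v
  have 1: "q (x + y) (x + y) = q x x + q y y + (q x y + q y x)"
    "q (x - y) (x - y) = q x x + q y y - (q x y + q y x)"
    by (simp_all add: q_def add diff cinner_add_left cinner_add_right cinner.diff_left
        cinner.diff_right)
  have 2: "q (x + \<i> *\<^sub>C y) (x + \<i> *\<^sub>C y) = q x x + q y y + \<i> * (q x y - q y x)"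
    "q (x - \<i> *\<^sub>C y) (x - \<i> *\<^sub>C y) = q x x + q y y - \<i> * (q x y - q y x)"
    by (simp_all add: q_def add diff cinner_add_left cinner_add_right cinner.diff_left
        cinner.diff_right cinner_scaleC_left cinner_scaleC_right bounded_clinear_scaleC[OF assms]
        complex_eq_iff)
  have "4 * q x y = q (x + y) (x + y) - q (x - y) (x - y)
     - \<i> * q (x + \<i> *\<^sub>C y) (x + \<i> *\<^sub>C y) + \<i> * q (x - \<i> *\<^sub>C y) (x - \<i> *\<^sub>C y)"
    unfolding 1 2 by (simp add: complex_eq_iff)
  then show ?thesis by (simp add: q_def mult.commute)
qed

lemma bounded_clinear_eqI:
  assumes "bounded_clinear A" "bounded_clinear B" "\<And>x. cinner x (A x) = cinner x (B x)"
  shows "A = B"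
proof
  fix y
  have "cinner x (A y) = cinner x (B y)" for x
    using polarization[OF assms(1), of x y] polarization[OF assms(2), of x y] by (simp only: assms(3))
  then show "A y = B y" by (metis cinner_commute cinner_eqI)
qed

section \<open>Positive operators\<close>

lemma positive_opD:
  assumes "positive_op A"
  shows positive_op_bounded_clinear: "bounded_clinear A"
    and positive_op_nonneg: "0 \<le> Re (cinner x (A x))"
    and positive_op_real: "cinner x (A x) = of_real (Re (cinner x (A x)))"
proof -
  show "bounded_clinear A" using assms by (simp add: positive_op_def)
  have "cinner x (A x) \<in> \<real>\<^sub>\<ge>\<^sub>0" using assms by (simp add: positive_op_def)
  then show "0 \<le> Re (cinner x (A x))" "cinner x (A x) = of_real (Re (cinner x (A x)))"
    by (auto simp: complex_nonneg_Reals_iff complex_eq_iff)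
qed

lemma positive_op_selfadjoint:
  assumes "positive_op A" shows "cinner (A x) y = cinner x (A y)"
proof -
  have "bounded_linear A"
    using assms by (simp add: positive_op_def bounded_clinear_imp_bounded_linear)
  then interpret bounded_linear A .
  have "cinner y (A x) = cnj (cinner x (A y))"
    by (rule form_hermitian[of "\<lambda>x y. cinner x (A y)"])
      (use assms nonneg_Reals_subset_Reals in \<open>auto simp: add cinner_add_left cinner_add_right
        cinner_scaleC_left cinner_scaleC_right positive_op_def bounded_clinear_scaleC\<close>)
  then show ?thesis by (metis cinner_commute)
qed

lemma positive_op_Cauchy_Schwarz:
  assumes "positive_op A"
  shows "(cmod (cinner x (A y)))\<^sup>2 \<le> Re (cinner x (A x)) * Re (cinner y (A y))"
proof -
  have "bounded_linear A"
    using assms by (simp add: positive_op_def bounded_clinear_imp_bounded_linear)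
  then interpret bounded_linear A .
  show ?thesis
    by (rule form_Cauchy_Schwarz[of "\<lambda>x y. cinner x (A y)"])
      (use assms in \<open>auto simp: add cinner_add_left cinner_add_right
        cinner_scaleC_left cinner_scaleC_right positive_op_def bounded_clinear_scaleC\<close>)
qed

lemma positive_op_eq_0:
  assumes "positive_op A" "cinner x (A x) = 0" shows "A x = 0"
  using positive_op_Cauchy_Schwarz[OF assms(1), of "A x" x] assms(2)
  by (simp add: cinner_self_eq_zero_iff)

lemma positive_op_contraction:
  assumes "positive_op A" "\<And>x. Re (cinner x (A x)) \<le> (norm x)\<^sup>2"
  shows "norm (A x) \<le> norm x"
proof (cases "A x = 0")
  case False
  have "((norm (A x))\<^sup>2)\<^sup>2 \<le> Re (cinner (A x) (A (A x))) * Re (cinner x (A x))"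
    using positive_op_Cauchy_Schwarz[OF assms(1), of "A x" x]
    by (simp add: cinner_self norm_power)
  also have "\<dots> \<le> (norm (A x))\<^sup>2 * (norm x)\<^sup>2"
    by (intro mult_mono assms(2) positive_op_nonneg[OF assms(1)]) simp
  finally have "(norm (A x))\<^sup>2 \<le> (norm x)\<^sup>2"
    using False by (simp add: power2_eq_square)
  then show ?thesis by (rule power2_le_imp_le) simp
qed simp

section \<open>Subspaces, Riesz representation and extension by density\<close>

text \<open>Complex-linear subspaces, closed or not.\<close>

definition csubspace :: "'a::complex_hilbert_space set \<Rightarrow> bool" where
  "csubspace V \<longleftrightarrow> 0 \<in> V \<and> (\<forall>x\<in>V. \<forall>y\<in>V. x + y \<in> V) \<and> (\<forall>c. \<forall>x\<in>V. c *\<^sub>C x \<in> V)"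

lemma csubspace_UNIV [simp]: "csubspace UNIV"
  by (simp add: csubspace_def)

lemma csubspaceD:
  assumes "csubspace V"
  shows "0 \<in> V" "x \<in> V \<Longrightarrow> y \<in> V \<Longrightarrow> x + y \<in> V" "x \<in> V \<Longrightarrow> c *\<^sub>C x \<in> V"
    "x \<in> V \<Longrightarrow> r *\<^sub>R x \<in> V" "x \<in> V \<Longrightarrow> y \<in> V \<Longrightarrow> x - y \<in> V"
proof -
  show *: "0 \<in> V" "x \<in> V \<Longrightarrow> y \<in> V \<Longrightarrow> x + y \<in> V" "x \<in> V \<Longrightarrow> c *\<^sub>C x \<in> V"
    "x \<in> V \<Longrightarrow> r *\<^sub>R x \<in> V" for x y c r
    using assms by (auto simp: csubspace_def scaleR_scaleC)
  show "x \<in> V \<Longrightarrow> y \<in> V \<Longrightarrow> x - y \<in> V"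
    using *(2)[of x "- y"] *(3)[of y "-1"] by (simp add: scaleC_minus1)
qed

lemma csubspace_sum: "csubspace V \<Longrightarrow> (\<And>i. i \<in> I \<Longrightarrow> f i \<in> V) \<Longrightarrow> sum f I \<in> V"
  by (induction I rule: infinite_finite_induct) (auto intro: csubspaceD)

lemma csubspace_closure:
  assumes "csubspace V" shows "csubspace (closure V)"
  unfolding csubspace_def
proof (intro conjI ballI allI)
  show "0 \<in> closure V" using assms closure_subset csubspaceD(1) by blast
next
  fix x y assume "x \<in> closure V" "y \<in> closure V"
  then obtain f g where "\<And>n. f n \<in> V" "f \<longlonglongrightarrow> x" "\<And>n. g n \<in> V" "g \<longlonglongrightarrow> y"
    by (auto simp: closure_sequential)
  then show "x + y \<in> closure V"
    unfolding closure_sequential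
    by (intro exI[of _ "\<lambda>n. f n + g n"]) (auto intro: csubspaceD assms tendsto_add)
next
  fix c x assume "x \<in> closure V"
  then obtain f where "\<And>n. f n \<in> V" "f \<longlonglongrightarrow> x"
    by (auto simp: closure_sequential)
  then show "c *\<^sub>C x \<in> closure V"
    unfolding closure_sequential
    by (intro exI[of _ "\<lambda>n. c *\<^sub>C f n"])
      (auto intro: csubspaceD assms bounded_linear.tendsto[OF bounded_linear_scaleC])
qed

lemma csubspace_closure_range:
  assumes "bounded_clinear S" shows "csubspace (closure (range S))"
proof (rule csubspace_closure)
  interpret bounded_linear S by (rule bounded_clinear_imp_bounded_linear) fact
  show "csubspace (range S)"
    unfolding csubspace_def
  proof (intro conjI ballI allI)
    show "0 \<in> range S" using zero by (metis rangeI)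
    show "x + y \<in> range S" if "x \<in> range S" "y \<in> range S" for x y
      using that add by (metis (no_types, lifting) imageE rangeI)
    show "c *\<^sub>C x \<in> range S" if "x \<in> range S" for c x
      using that bounded_clinear_scaleC[OF assms] by (metis imageE rangeI)
  qed
qed

lemma closure_range_sequence:
  fixes S :: "'a \<Rightarrow> 'b::first_countable_topology"
  assumes "x \<in> closure (range S)"
  obtains h where "(\<lambda>n. S (h n)) \<longlonglongrightarrow> x"
proof -
  obtain f where f: "\<forall>n. f n \<in> range S" "f \<longlonglongrightarrow> x"
    using assms unfolding closure_sequential by (elim exE conjE)
  have "S (inv S (f n)) = f n" for n using f(1)[rule_format] by (rule f_inv_into_f)
  with f(2) show ?thesis by (intro that[of "\<lambda>n. inv S (f n)"]) simp
qed

lemma in_closure_range [simp]: "S h \<in> closure (range S)"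
  by (rule subsetD[OF closure_subset rangeI])

lemma orthogonal_range_eq_0:
  assumes "u \<in> closure (range S)" "\<And>k. cinner u (S k) = 0" shows "u = 0"
proof -
  obtain h where h: "(\<lambda>n. S (h n)) \<longlonglongrightarrow> u" using closure_range_sequence assms(1) .
  have "(\<lambda>n. cinner u (S (h n))) \<longlonglongrightarrow> cinner u u"
    by (intro cinner.tendsto h tendsto_const)
  then have "cinner u u = 0" by (simp add: assms(2) LIMSEQ_const_iff)
  then show ?thesis by (simp add: cinner_self_eq_zero_iff)
qed

lemma bounded_clinear_on_diff:
  assumes "bounded_clinear_on V W A" "csubspace V" "x \<in> V" "y \<in> V"
  shows "A (x - y) = A x - A y"
proof -
  have "A (x + (-1) *\<^sub>C y) = A x + (-1) *\<^sub>C A y"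
    using assms bounded_clinear_onD[OF assms(1)] csubspaceD[OF assms(2)] by metis
  then show ?thesis by (simp add: scaleC_minus1)
qed

lemma bounded_clinear_on_tendsto:
  assumes A: "bounded_clinear_on V W A" and V: "csubspace V"
    and "\<And>n. f n \<in> V" "x \<in> V" "f \<longlonglongrightarrow> x"
  shows "(\<lambda>n. A (f n)) \<longlonglongrightarrow> A x"
proof -
  obtain K where K: "\<And>x. x \<in> V \<Longrightarrow> norm (A x) \<le> K * norm x"
    using A unfolding bounded_clinear_on_def by blast
  have "(\<lambda>n. f n - x) \<longlonglongrightarrow> 0" using assms(5) by (simp add: LIM_zero)
  then have "(\<lambda>n. K * norm (f n - x)) \<longlonglongrightarrow> 0"
    using tendsto_mult_right_zero tendsto_norm_zero by blast
  then have "(\<lambda>n. A (f n) - A x) \<longlonglongrightarrow> 0"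
    by (rule Lim_null_comparison[rotated])
      (use K assms in \<open>auto simp: csubspaceD bounded_clinear_on_diff[OF A V, symmetric]\<close>)
  then show ?thesis by (simp add: LIM_zero_iff)
qed

text \<open>Riesz representation of a functional \<open>f\<close> that is bounded with respect to the seminorm
  \<open>h \<mapsto> \<parallel>S h\<parallel>\<close>. The representing vector is the limit of \<open>S h\<close> along a minimising sequence of
  \<open>\<parallel>S h\<parallel>\<^sup>2 - 2 Re (f h)\<close>. With \<open>S\<close> the identity this is the usual theorem on a subspace.\<close>

lemma Riesz_seminorm:
  fixes f :: "'a::complex_hilbert_space \<Rightarrow> complex" and S :: "'a \<Rightarrow> 'b::complex_hilbert_space"
  assumes V: "csubspace V"
    and Sadd: "\<And>x y. x \<in> V \<Longrightarrow> y \<in> V \<Longrightarrow> S (x + y) = S x + S y"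
    and Sscale: "\<And>c x. x \<in> V \<Longrightarrow> S (c *\<^sub>C x) = c *\<^sub>C S x"
    and fadd: "\<And>x y. x \<in> V \<Longrightarrow> y \<in> V \<Longrightarrow> f (x + y) = f x + f y"
    and fscale: "\<And>c x. x \<in> V \<Longrightarrow> f (c *\<^sub>C x) = c * f x"
    and bd: "\<And>x. x \<in> V \<Longrightarrow> cmod (f x) \<le> c * norm (S x)"
  obtains z where "z \<in> closure (S ` V)" "\<And>h. h \<in> V \<Longrightarrow> f h = cinner z (S h)"
proof -
  define J where "J h = (norm (S h))\<^sup>2 - 2 * Re (f h)" for h
  have SR: "S (r *\<^sub>R x) = r *\<^sub>R S x" and fR: "f (r *\<^sub>R x) = r *\<^sub>R f x" if "x \<in> V" for r x
    using that by (simp_all add: scaleR_scaleC Sscale fscale scaleR_conv_of_real)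
  have J_lower: "- c\<^sup>2 \<le> J h" if "h \<in> V" for h
  proof -
    have "2 * Re (f h) \<le> 2 * (c * norm (S h))"
      using bd[OF that] complex_Re_le_cmod[of "f h"] by linarith
    moreover have "0 \<le> (norm (S h) - c)\<^sup>2" by simp
    ultimately show ?thesis by (simp add: J_def power2_diff mult.commute)
  qed
  define I where "I = (INF h\<in>V. J h)"
  have bddJ: "bdd_below (J ` V)" using J_lower by (rule bdd_belowI2)
  have I_le: "I \<le> J h" if "h \<in> V" for h
    unfolding I_def using bddJ that by (rule cINF_lower)
  have "\<exists>h\<in>V. J h < I + 1 / real (Suc n)" for n
  proof -
    have "\<exists>h\<in>V. J h < I + 1 / real (Suc n)"
      using cINF_less_iff[of V J "I + 1 / real (Suc n)"] bddJ csubspaceD(1)[OF V]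
      by (auto simp: I_def)
    then show ?thesis .
  qed
  then obtain h where hV: "\<And>n. h n \<in> V" and hJ: "\<And>n. J (h n) < I + 1 / real (Suc n)"
    by metis
  \<comment> \<open>The parallelogram law turns near-minimality into closeness.\<close>
  have dist: "(norm (S (h i) - S (h j)))\<^sup>2 \<le> 2 / real (Suc i) + 2 / real (Suc j)" for i j
  proof -
    define k where "k = (1/2::real) *\<^sub>R (h i + h j)"
    have kV: "k \<in> V" by (simp add: k_def csubspaceD V hV)
    have Sk: "S k = (1/2::real) *\<^sub>R (S (h i) + S (h j))"
      by (simp add: k_def SR csubspaceD V hV Sadd)
    have fk: "Re (f k) = (Re (f (h i)) + Re (f (h j))) / 2"
      by (simp add: k_def fR csubspaceD V hV fadd)
    have "(norm (S k))\<^sup>2 = ((norm (S (h i)))\<^sup>2 + (norm (S (h j)))\<^sup>2 + 2 * Re (cinner (S (h i)) (S (h j)))) / 4"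
      unfolding Sk by (simp only: norm_scaleR power_mult_distrib norm_add_sq) (simp add: power2_eq_square)
    then have "(norm (S (h i) - S (h j)))\<^sup>2 = 2 * J (h i) + 2 * J (h j) - 4 * J k"
      using fk by (simp add: J_def norm_diff_sq field_simps)
    also have "\<dots> \<le> 2 / real (Suc i) + 2 / real (Suc j)"
      using hJ[of i] hJ[of j] I_le[OF kV] by linarith
    finally show ?thesis .
  qed
  have "Cauchy (\<lambda>n. S (h n))"
  proof (rule metric_CauchyI)
    fix e :: real assume e: "e > 0"
    then obtain M where M: "1 / real (Suc M) < e\<^sup>2 / 4"
      using nat_approx_posE[of "e\<^sup>2 / 4"] by auto
    have "dist (S (h i)) (S (h j)) < e" if ij: "i \<ge> M" "j \<ge> M" for i j
    proof -
      have "1 / real (Suc i) \<le> 1 / real (Suc M)" "1 / real (Suc j) \<le> 1 / real (Suc M)"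
        using ij by (auto intro!: divide_left_mono)
      then have "(norm (S (h i) - S (h j)))\<^sup>2 < e\<^sup>2"
        using dist[of i j] M by simp
      then show ?thesis using e by (simp add: dist_norm power2_less_imp_less)
    qed
    then show "\<exists>M. \<forall>m\<ge>M. \<forall>n\<ge>M. dist (S (h m)) (S (h n)) < e" by blast
  qed
  then obtain z where z: "(\<lambda>n. S (h n)) \<longlonglongrightarrow> z"
    using Cauchy_convergent convergent_def by blast
  have zcl: "z \<in> closure (S ` V)"
    unfolding closure_sequential using z hV by (intro exI[of _ "\<lambda>n. S (h n)"]) simp
  \<comment> \<open>The value of \<open>J\<close> at \<open>h n + t k\<close> is at least the infimum; pass to the limit in \<open>n\<close>.\<close>
  have quad: "0 \<le> 2 * t * (Re (cinner z (S k)) - Re (f k)) + t\<^sup>2 * (norm (S k))\<^sup>2" if k: "k \<in> V" for t k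
  proof -
    have ineq: "- (1 / real (Suc n)) \<le> 2 * t * (Re (cinner (S (h n)) (S k)) - Re (f k)) + t\<^sup>2 * (norm (S k))\<^sup>2" for n
    proof -
      have "h n + t *\<^sub>R k \<in> V" by (simp add: csubspaceD V hV k)
      then have "J (h n) - 1 / real (Suc n) \<le> J (h n + t *\<^sub>R k)"
        using hJ[of n] I_le by force
      also have "J (h n + t *\<^sub>R k) = J (h n) + 2 * t * (Re (cinner (S (h n)) (S k)) - Re (f k)) + t\<^sup>2 * (norm (S k))\<^sup>2"
        by (simp add: J_def Sadd fadd SR fR csubspaceD V hV k norm_add_sq cinner_scaleR_right
            power_mult_distrib algebra_simps)
      finally show ?thesis by simp
    qed
    have "(\<lambda>n. - (1 / real (Suc n))) \<longlonglongrightarrow> 0"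
      using LIMSEQ_inverse_real_of_nat_add_minus[of 0] by (simp add: inverse_eq_divide)
    moreover have "(\<lambda>n. 2 * t * (Re (cinner (S (h n)) (S k)) - Re (f k)) + t\<^sup>2 * (norm (S k))\<^sup>2) \<longlonglongrightarrow>
        2 * t * (Re (cinner z (S k)) - Re (f k)) + t\<^sup>2 * (norm (S k))\<^sup>2"
      by (intro tendsto_intros cinner.tendsto z)
    ultimately show ?thesis by (rule LIMSEQ_le) (use ineq in blast)
  qed
  \<comment> \<open>A negative value occurs at \<open>t = - b / N\<close> unless the linear coefficient vanishes.\<close>
  have Re_eq: "Re (cinner z (S k)) = Re (f k)" if k: "k \<in> V" for k
  proof (rule ccontr)
    define b where "b = Re (cinner z (S k)) - Re (f k)"
    define N where "N = (norm (S k))\<^sup>2 + 1"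
    assume "Re (cinner z (S k)) \<noteq> Re (f k)"
    then have b: "b \<noteq> 0" by (simp add: b_def)
    have N: "N > 0" by (simp add: N_def add_nonneg_pos)
    have "0 \<le> 2 * (- b / N) * b + (- b / N)\<^sup>2 * (norm (S k))\<^sup>2"
      using quad[OF k, of "- b / N"] by (simp add: b_def)
    also have "\<dots> \<le> 2 * (- b / N) * b + (- b / N)\<^sup>2 * N"
      by (intro add_left_mono mult_left_mono) (simp_all add: N_def)
    also have "\<dots> = - b\<^sup>2 / N" using N by (simp add: power2_eq_square field_simps)
    finally show False using b N by (simp add: field_simps)
  qed
  have "f k = cinner z (S k)" if k: "k \<in> V" for k
  proof -
    have "Im (f k) = - Re (f (\<i> *\<^sub>C k))" by (simp add: fscale k)
    also have "\<dots> = - Re (cinner z (S (\<i> *\<^sub>C k)))" using Re_eq k by (simp add: csubspaceD V)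
    also have "\<dots> = Im (cinner z (S k))" by (simp add: Sscale k cinner_scaleC_right)
    finally show ?thesis using Re_eq[OF k] by (simp add: complex_eq_iff)
  qed
  with zcl that show ?thesis by blast
qed

lemma adjoint_on:
  assumes S: "csubspace S" "closed S" and A: "bounded_clinear_on S T A" and y: "y \<in> T"
  shows adjoint_on_mem: "adjoint_on S T A y \<in> S"
    and cinner_adjoint_on: "x \<in> S \<Longrightarrow> cinner (adjoint_on S T A y) x = cinner y (A x)"
proof -
  obtain K where K: "\<And>x. x \<in> S \<Longrightarrow> norm (A x) \<le> K * norm x"
    using A unfolding bounded_clinear_on_def by blast
  obtain z where z: "z \<in> closure ((\<lambda>x. x) ` S)" "\<And>x. x \<in> S \<Longrightarrow> cinner y (A x) = cinner z x"
  proof (rule Riesz_seminorm[OF S(1), of "\<lambda>x. x" "\<lambda>x. cinner y (A x)" "norm y * K"])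
    show "cmod (cinner y (A x)) \<le> norm y * K * norm x" if "x \<in> S" for x
      using Cauchy_Schwarz[of y "A x"] mult_left_mono[OF K[OF that], of "norm y"]
      by (simp add: mult.assoc)
  qed (auto simp: bounded_clinear_onD[OF A] cinner_add_right cinner_scaleC_right)
  have ex: "z \<in> S \<and> (\<forall>x\<in>S. cinner z x = cinner y (A x))"
    using z S by simp
  have "w = z" if w: "w \<in> S \<and> (\<forall>x\<in>S. cinner w x = cinner y (A x))" for w
  proof -
    have "w - z \<in> S" using w ex S by (simp add: csubspaceD)
    then have "cinner (w - z) (w - z) = 0" using w ex by (simp add: cinner.diff_left)
    then show ?thesis by (simp add: cinner_self_eq_zero_iff)
  qed
  with ex have "(THE z. z \<in> S \<and> (\<forall>x\<in>S. cinner z x = cinner y (A x))) = z" by (rule the_equality)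
  then have "adjoint_on S T A y = z" using y by (simp add: adjoint_on_def)
  with ex show "adjoint_on S T A y \<in> S"
    "x \<in> S \<Longrightarrow> cinner (adjoint_on S T A y) x = cinner y (A x)" by auto
qed

text \<open>An operator dominated by \<open>S\<close> factors through the closure of the range of \<open>S\<close>.\<close>

lemma factor_through_range:
  fixes S :: "'a::complex_hilbert_space \<Rightarrow> 'b::complex_hilbert_space"
    and R :: "'a \<Rightarrow> 'c::complex_hilbert_space"
  assumes S: "bounded_clinear S" and R: "bounded_clinear R"
    and dom: "\<And>h. norm (R h) \<le> c * norm (S h)"
    and T: "closed T" "range R \<subseteq> T"
  obtains C where "bounded_clinear_on (closure (range S)) T C" "\<And>h. C (S h) = R h"
    "\<And>x. x \<in> closure (range S) \<Longrightarrow> norm (C x) \<le> c * norm x"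
proof -
  interpret S: bounded_linear S by (rule bounded_clinear_imp_bounded_linear) fact
  interpret R: bounded_linear R by (rule bounded_clinear_imp_bounded_linear) fact
  define f where "f y = R (inv S y)" for y
  have R_eq: "R h = R k" if "S h = S k" for h k
    using dom[of "h - k"] that by (simp add: S.diff R.diff)
  have fS: "f (S h) = R h" for h
    unfolding f_def by (rule R_eq) (simp add: f_inv_into_f)
  have lip: "norm (f x - f y) \<le> c * norm (x - y)" if xy: "x \<in> range S" "y \<in> range S" for x y
  proof -
    obtain h k where "x = S h" "y = S k" using xy by blast
    then show ?thesis using dom[of "h - k"] by (simp add: fS S.diff R.diff)
  qed
  have uc: "uniformly_continuous_on (range S) f"
    unfolding uniformly_continuous_on_def
  proof (intro allI impI)
    fix e :: real assume e: "e > 0"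
    show "\<exists>d>0. \<forall>x\<in>range S. \<forall>x'\<in>range S. dist x' x < d \<longrightarrow> dist (f x') (f x) < e"
    proof (intro exI[of _ "e / (\<bar>c\<bar> + 1)"] conjI ballI impI)
      fix x x' assume *: "x \<in> range S" "x' \<in> range S" "dist x' x < e / (\<bar>c\<bar> + 1)"
      have "dist (f x') (f x) \<le> c * dist x' x" using lip * by (simp add: dist_norm)
      also have "\<dots> \<le> (\<bar>c\<bar> + 1) * dist x' x" by (intro mult_right_mono) auto
      also have "\<dots> < e" using *(3) by (simp add: field_simps)
      finally show "dist (f x') (f x) < e" .
    qed (use e in simp)
  qed
  obtain C where C: "uniformly_continuous_on (closure (range S)) C"
    and Cf: "\<And>x. x \<in> range S \<Longrightarrow> f x = C x"
    by (rule uniformly_continuous_on_extension_on_closure[OF uc]) (rule that)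
  have CS: "C (S h) = R h" for h using Cf fS by auto
  have sub: "csubspace (closure (range S))" by (rule csubspace_closure_range) fact
  have lim: "(\<lambda>n. R (h n)) \<longlonglongrightarrow> C x" if "x \<in> closure (range S)" "(\<lambda>n. S (h n)) \<longlonglongrightarrow> x" for x h
  proof -
    have "continuous_on (closure (range S)) C" by (rule uniformly_continuous_imp_continuous) fact
    then have "(\<lambda>n. C (S (h n))) \<longlonglongrightarrow> C x"
      unfolding continuous_on_sequentially comp_def using that by auto
    then show ?thesis by (simp add: CS)
  qed
  have bound: "norm (C x) \<le> c * norm x" if x: "x \<in> closure (range S)" for x
  proof -
    obtain h where h: "(\<lambda>n. S (h n)) \<longlonglongrightarrow> x" using closure_range_sequence x .
    show ?thesis
      by (rule LIMSEQ_le[OF tendsto_norm[OF lim[OF x h]] tendsto_mult_left[OF tendsto_norm[OF h]]])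
        (use dom in blast)
  qed
  have "bounded_clinear_on (closure (range S)) T C"
    unfolding bounded_clinear_on_def
  proof (intro conjI ballI allI exI[of _ c] Pi_I bound)
    fix x assume x: "x \<in> closure (range S)"
    obtain h where h: "(\<lambda>n. S (h n)) \<longlonglongrightarrow> x" using closure_range_sequence x .
    show "C x \<in> T"
      by (rule closed_sequentially[OF T(1) _ lim[OF x h]]) (use T(2) in blast)
    show "C (a *\<^sub>C x) = a *\<^sub>C C x" for a
    proof (rule LIMSEQ_unique)
      show "(\<lambda>n. R (a *\<^sub>C h n)) \<longlonglongrightarrow> C (a *\<^sub>C x)"
        by (rule lim) (use sub x h bounded_linear.tendsto[OF bounded_linear_scaleC]
            in \<open>auto simp: csubspaceD bounded_clinear_scaleC[OF S]\<close>)
      show "(\<lambda>n. R (a *\<^sub>C h n)) \<longlonglongrightarrow> a *\<^sub>C C x"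
        unfolding bounded_clinear_scaleC[OF R]
        by (intro bounded_linear.tendsto[OF bounded_linear_scaleC] lim x h)
    qed
    fix y assume y: "y \<in> closure (range S)"
    obtain k where k: "(\<lambda>n. S (k n)) \<longlonglongrightarrow> y" using closure_range_sequence y .
    show "C (x + y) = C x + C y"
    proof (rule LIMSEQ_unique)
      show "(\<lambda>n. R (h n + k n)) \<longlonglongrightarrow> C (x + y)"
        by (rule lim) (use sub x y h k in \<open>auto simp: csubspaceD S.add intro: tendsto_add\<close>)
      show "(\<lambda>n. R (h n + k n)) \<longlonglongrightarrow> C x + C y"
        unfolding R.add by (intro tendsto_add lim x h y k)
    qed
  qed
  then show ?thesis using CS bound by (rule that)
qed

section \<open>Square roots of positive contractions\<close>

text \<open>The Taylor coefficients of \<open>sqrt (1 - z)\<close>. Only the first is positive and the partial sums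
  are nonnegative, so the series converges absolutely for operators of norm at most \<open>1\<close>.\<close>

definition sqrt_coeff :: "nat \<Rightarrow> real" where
  "sqrt_coeff n = (- 1) ^ n * ((1/2) gchoose n)"

lemma sqrt_coeff_0 [simp]: "sqrt_coeff 0 = 1"
  by (simp add: sqrt_coeff_def)

lemma sqrt_coeff_Suc: "real (Suc n) * sqrt_coeff (Suc n) = (real n - 1/2) * sqrt_coeff n"
proof -
  have "real (Suc n) * ((1/2) gchoose Suc n) = (1/2 - real n) * ((1/2::real) gchoose n)"
    using gbinomial_mult_1[of "1/2::real" n] by (simp add: algebra_simps)
  then have "(- 1) ^ Suc n * (real (Suc n) * ((1/2) gchoose Suc n)) =
      (- 1) ^ Suc n * ((1/2 - real n) * ((1/2::real) gchoose n))"
    by (rule arg_cong)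
  then show ?thesis unfolding sqrt_coeff_def power_Suc by (simp only: mult_ac) (simp add: algebra_simps)
qed

lemma sqrt_coeff_nonpos: "n > 0 \<Longrightarrow> sqrt_coeff n \<le> 0"
proof (induction n rule: nat_induct_non_zero)
  case 1
  then show ?case using sqrt_coeff_Suc[of 0] by simp
next
  case (Suc n)
  have "real (Suc n) * sqrt_coeff (Suc n) \<le> 0"
    unfolding sqrt_coeff_Suc using Suc by (intro mult_nonneg_nonpos) auto
  then show ?case by (simp add: mult_le_0_iff)
qed

text \<open>The partial sums of the coefficients at \<open>z = 1\<close> have a closed form; for \<open>n > 0\<close> both
  factors on the right are nonpositive.\<close>

lemma sqrt_coeff_partial_sum: "(\<Sum>k\<le>n. sqrt_coeff k) = (1 - 2 * real n) * sqrt_coeff n"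
proof (induction n)
  case (Suc n)
  have "(1 - 2 * real n) * sqrt_coeff n = - 2 * (real (Suc n) * sqrt_coeff (Suc n))"
    unfolding sqrt_coeff_Suc by (simp add: algebra_simps)
  then show ?case using Suc by (simp add: algebra_simps)
qed simp

lemma sqrt_coeff_partial_sum_nonneg: "0 \<le> (\<Sum>k<n. sqrt_coeff k)"
proof (cases n)
  case (Suc k)
  have "0 \<le> (1 - 2 * real k) * sqrt_coeff k"
    using sqrt_coeff_nonpos[of k] by (cases "k = 0") (auto intro: mult_nonpos_nonpos)
  then show ?thesis by (simp only: Suc lessThan_Suc_atMost sqrt_coeff_partial_sum)
qed simp

lemma sum_abs_sqrt_coeff: "(\<Sum>k<n. \<bar>sqrt_coeff k\<bar>) \<le> 2"
proof (cases n)
  case (Suc m)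
  have "\<bar>sqrt_coeff k\<bar> = (if k = 0 then 2 else 0) - sqrt_coeff k" for k
    using sqrt_coeff_nonpos[of k] by (cases "k = 0") auto
  then have "(\<Sum>k<n. \<bar>sqrt_coeff k\<bar>) = (\<Sum>k<n. if k = 0 then 2 else 0) - (\<Sum>k<n. sqrt_coeff k)"
    by (simp only: sum_subtractf)
  also have "(\<Sum>k<n. if k = 0 then 2 else 0 :: real) = 2" using Suc by simp
  finally show ?thesis using sqrt_coeff_partial_sum_nonneg[of n] by simp
qed simp

lemma summable_abs_sqrt_coeff: "summable (\<lambda>n. \<bar>sqrt_coeff n\<bar>)"
  by (rule summableI_nonneg_bounded[of _ 2]) (auto intro: sum_abs_sqrt_coeff)

text \<open>Vandermonde's identity with both upper indices \<open>1/2\<close>, that is,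
  \<open>sqrt (1 - z)\<^sup>2 = 1 - z\<close> as formal power series.\<close>

lemma sqrt_coeff_convolution:
  "(\<Sum>i\<le>n. sqrt_coeff i * sqrt_coeff (n - i)) = (if n = 0 then 1 else if n = 1 then - 1 else 0)"
proof -
  have "(\<Sum>i\<le>n. sqrt_coeff i * sqrt_coeff (n - i)) =
      (\<Sum>i\<le>n. (- 1) ^ n * (((1/2) gchoose i) * ((1/2) gchoose (n - i))))"
  proof (intro sum.cong refl)
    fix i assume "i \<in> {..n}"
    then have "(- 1) ^ n = (- 1) ^ i * (- 1 :: real) ^ (n - i)" by (simp flip: power_add)
    then show "sqrt_coeff i * sqrt_coeff (n - i) =
        (- 1) ^ n * (((1/2) gchoose i) * ((1/2) gchoose (n - i)))"
      by (simp add: sqrt_coeff_def)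
  qed
  also have "\<dots> = (- 1) ^ n * ((1/2 + 1/2) gchoose n)"
    by (simp only: sum_distrib_left[symmetric] gbinomial_Vandermonde[symmetric] atLeast0AtMost)
  also have "((1/2 + 1/2 :: real) gchoose n) = of_nat (1 choose n)"
    by (simp add: binomial_gbinomial)
  also have "(- 1) ^ n * real (1 choose n) = (if n = 0 then 1 else if n = 1 then - 1 else 0)"
    by (cases n) (auto simp: binomial_eq_0)
  finally show ?thesis .
qed

context
  fixes Z :: "'a::complex_hilbert_space \<Rightarrow> 'a"
  assumes lin: "bounded_clinear Z" and contr: "\<And>x. norm (Z x) \<le> norm x"
begin

interpretation Z: bounded_linear Z by (rule bounded_clinear_imp_bounded_linear) (rule lin)

text \<open>The partial sums and the value of the binomial series of \<open>sqrt (1 - Z)\<close> at a vector. The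
  series is only formed pointwise, which avoids a Banach algebra of operators.\<close>

definition sqrt_partial :: "nat \<Rightarrow> 'a \<Rightarrow> 'a" where
  "sqrt_partial N x = (\<Sum>n<N. sqrt_coeff n *\<^sub>R (Z ^^ n) x)"

definition sqrt_series :: "'a \<Rightarrow> 'a" where
  "sqrt_series x = (\<Sum>n. sqrt_coeff n *\<^sub>R (Z ^^ n) x)"

lemma norm_funpow_contraction: "norm ((Z ^^ n) x) \<le> norm x"
proof (induction n)
  case (Suc n)
  show ?case using contr[of "(Z ^^ n) x"] Suc by simp
qed simp

lemma bounded_clinear_funpow: "bounded_clinear (Z ^^ n)"
proof (induction n)
  case (Suc n)
  show ?case
    by (rule bounded_clinearI)
      (auto simp: bounded_clinear_scaleC[OF Suc] bounded_clinear_scaleC[OF lin] comp_def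
        intro: bounded_linear_compose[OF Z.bounded_linear_axioms] bounded_clinear_imp_bounded_linear[OF Suc])
qed (use bounded_clinear_id in \<open>simp add: id_def\<close>)

lemma bounded_clinear_sqrt_partial: "bounded_clinear (sqrt_partial N)"
  unfolding sqrt_partial_def [abs_def]
  by (intro bounded_clinear_sum bounded_clinear_scaleR bounded_clinear_funpow)

lemma norm_sqrt_partial: "norm (sqrt_partial N x) \<le> 2 * norm x"
proof -
  have "norm (sqrt_partial N x) \<le> (\<Sum>n<N. \<bar>sqrt_coeff n\<bar> * norm x)"
    unfolding sqrt_partial_def
    by (rule sum_norm_le) (simp add: mult_left_mono norm_funpow_contraction)
  also have "\<dots> \<le> 2 * norm x"
    by (simp only: sum_distrib_right[symmetric] mult_right_mono[OF sum_abs_sqrt_coeff] norm_ge_zero)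
  finally show ?thesis .
qed

lemma summable_sqrt_series: "summable (\<lambda>n. sqrt_coeff n *\<^sub>R (Z ^^ n) x)"
proof (rule summable_comparison_test')
  show "summable (\<lambda>n. \<bar>sqrt_coeff n\<bar> * norm x)"
    by (rule summable_mult2) (rule summable_abs_sqrt_coeff)
qed (simp add: mult_left_mono norm_funpow_contraction)

lemma sqrt_partial_tendsto: "(\<lambda>N. sqrt_partial N x) \<longlonglongrightarrow> sqrt_series x"
  using summable_LIMSEQ[OF summable_sqrt_series]
  by (simp add: sqrt_partial_def sqrt_series_def)

lemma bounded_clinear_sqrt_series: "bounded_clinear sqrt_series"
proof -
  note p = bounded_clinear_onD(2,3)[OF bounded_clinear_sqrt_partial, simplified]
  have "sqrt_series (x + y) = sqrt_series x + sqrt_series y" for x y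
    by (rule LIMSEQ_unique[OF sqrt_partial_tendsto])
      (simp add: p tendsto_add sqrt_partial_tendsto)
  moreover have "sqrt_series (c *\<^sub>C x) = c *\<^sub>C sqrt_series x" for c x
    by (rule LIMSEQ_unique[OF sqrt_partial_tendsto])
      (simp add: p bounded_linear.tendsto[OF bounded_linear_scaleC] sqrt_partial_tendsto)
  moreover have "norm (sqrt_series x) \<le> 2 * norm x" for x
    by (rule LIMSEQ_le_const2[OF tendsto_norm[OF sqrt_partial_tendsto]])
      (auto intro: norm_sqrt_partial)
  ultimately show ?thesis unfolding bounded_clinear_on_def by blast
qed

text \<open>The square of the \<open>N\<close>-th partial sum differs from \<open>x - Z x\<close> by the terms outside the
  triangle \<open>i + j < N\<close>, which vanish in the limit as in Mertens' theorem.\<close>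

lemma sqrt_series_square: "sqrt_series (sqrt_series x) = x - Z x"
proof -
  let ?d = sqrt_coeff
  define r where "r N = (\<Sum>i<N. \<bar>?d i\<bar>) * (\<Sum>j<N. \<bar>?d j\<bar>) - (\<Sum>s<N. \<Sum>i\<le>s. \<bar>?d i\<bar> * \<bar>?d (s - i)\<bar>)" for N
  have r: "r \<longlonglongrightarrow> 0"
  proof -
    have s: "summable (\<lambda>k. norm (\<bar>?d k\<bar>))" using summable_abs_sqrt_coeff by simp
    have "(\<lambda>N. \<Sum>s<N. \<Sum>i\<le>s. \<bar>?d i\<bar> * \<bar>?d (s - i)\<bar>) \<longlonglongrightarrow> (\<Sum>k. \<bar>?d k\<bar>) * (\<Sum>k. \<bar>?d k\<bar>)"
      using Cauchy_product_sums[OF s s] by (simp only: sums_def)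
    moreover have "(\<lambda>N. \<Sum>i<N. \<bar>?d i\<bar>) \<longlonglongrightarrow> (\<Sum>k. \<bar>?d k\<bar>)"
      by (rule summable_LIMSEQ) (rule summable_abs_sqrt_coeff)
    ultimately have "r \<longlonglongrightarrow> (\<Sum>k. \<bar>?d k\<bar>) * (\<Sum>k. \<bar>?d k\<bar>) - (\<Sum>k. \<bar>?d k\<bar>) * (\<Sum>k. \<bar>?d k\<bar>)"
      unfolding r_def by (intro tendsto_intros)
    then show ?thesis by simp
  qed
  have triangle: "(\<Sum>(i,j)\<in>{(i,j). i + j < N}. (?d i * ?d j) *\<^sub>R (Z ^^ (i + j)) x) = x - Z x" if "N \<ge> 2" for N
  proof -
    have "(\<Sum>(i,j)\<in>{(i,j). i + j < N}. (?d i * ?d j) *\<^sub>R (Z ^^ (i + j)) x) =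
        (\<Sum>s<N. \<Sum>i\<le>s. (?d i * ?d (s - i)) *\<^sub>R (Z ^^ (i + (s - i))) x)"
      by (rule sum.triangle_reindex)
    also have "\<dots> = (\<Sum>s<N. (if s = 0 then 1 else if s = 1 then - 1 else 0) *\<^sub>R (Z ^^ s) x)"
      by (intro sum.cong refl) (simp flip: sqrt_coeff_convolution scaleR_sum_left)
    also have "\<dots> = (\<Sum>s\<in>{0, 1}. (if s = 0 then 1 else if s = 1 then - 1 else 0) *\<^sub>R (Z ^^ s) x)"
      by (rule sum.mono_neutral_right) (use that in auto)
    finally show ?thesis by simp
  qed
  have square: "sqrt_partial N (sqrt_partial N x) =
      (\<Sum>(i,j)\<in>{..<N} \<times> {..<N}. (?d i * ?d j) *\<^sub>R (Z ^^ (i + j)) x)" for N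
  proof -
    have "(Z ^^ i) (\<Sum>j<N. ?d j *\<^sub>R (Z ^^ j) x) = (\<Sum>j<N. ?d j *\<^sub>R (Z ^^ (i + j)) x)" for i
    proof -
      interpret Zi: bounded_linear "Z ^^ i"
        by (rule bounded_clinear_imp_bounded_linear) (rule bounded_clinear_funpow)
      show ?thesis by (simp add: Zi.sum Zi.scaleR funpow_add)
    qed
    then show ?thesis
      by (simp add: sqrt_partial_def scaleR_sum_right sum.cartesian_product)
  qed
  have split: "{..<N} \<times> {..<N} = {(i,j). i + j < N} \<union> ({..<N} \<times> {..<N} - {(i,j). i + j < N})"
    "{(i,j). i + j < N} \<subseteq> {..<N} \<times> {..<N}" for N :: nat by auto
  have fin: "finite {(i,j). i + j < (N::nat)}" for N
    by (rule finite_subset[OF split(2)]) simp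
  have "norm (sqrt_partial N (sqrt_partial N x) - (x - Z x)) \<le> r N * norm x" if "N \<ge> 2" for N
  proof -
    have "sqrt_partial N (sqrt_partial N x) - (x - Z x) =
        (\<Sum>(i,j)\<in>{..<N} \<times> {..<N} - {(i,j). i + j < N}. (?d i * ?d j) *\<^sub>R (Z ^^ (i + j)) x)"
      unfolding triangle[OF that, symmetric] square
      by (subst sum_diff) (use split(2) in auto)
    also have "norm \<dots> \<le> (\<Sum>(i,j)\<in>{..<N} \<times> {..<N} - {(i,j). i + j < N}. \<bar>?d i\<bar> * \<bar>?d j\<bar> * norm x)"
      by (rule sum_norm_le)
        (auto simp: abs_mult mult.assoc intro!: mult_left_mono norm_funpow_contraction)
    also have "\<dots> = (\<Sum>(i,j)\<in>{..<N} \<times> {..<N} - {(i,j). i + j < N}. \<bar>?d i\<bar> * \<bar>?d j\<bar>) * norm x"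
      by (simp add: sum_distrib_right case_prod_beta)
    also have "(\<Sum>(i,j)\<in>{..<N} \<times> {..<N} - {(i,j). i + j < N}. \<bar>?d i\<bar> * \<bar>?d j\<bar>) = r N"
      unfolding r_def sum.triangle_reindex[symmetric, of "\<lambda>i j. \<bar>?d i\<bar> * \<bar>?d j\<bar>"]
        sum_product sum.cartesian_product
      by (subst sum_diff) (use split(2) in auto)
    finally show ?thesis .
  qed
  then have "(\<lambda>N. sqrt_partial N (sqrt_partial N x) - (x - Z x)) \<longlonglongrightarrow> 0"
    by (intro Lim_null_comparison[OF _ tendsto_mult_left_zero[OF r]] eventually_sequentiallyI[of 2]) auto
  then have lim1: "(\<lambda>N. sqrt_partial N (sqrt_partial N x)) \<longlonglongrightarrow> x - Z x"
    by (simp add: LIM_zero_iff)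
  have "(\<lambda>N. sqrt_partial N (sqrt_partial N x - sqrt_series x)) \<longlonglongrightarrow> 0"
  proof (rule Lim_null_comparison)
    have "(\<lambda>N. sqrt_partial N x - sqrt_series x) \<longlonglongrightarrow> 0"
      using sqrt_partial_tendsto LIM_zero by blast
    then show "(\<lambda>N. 2 * norm (sqrt_partial N x - sqrt_series x)) \<longlonglongrightarrow> 0"
      using tendsto_mult_right_zero tendsto_norm_zero by blast
  qed (simp add: norm_sqrt_partial)
  then have "(\<lambda>N. sqrt_partial N (sqrt_partial N x - sqrt_series x) + sqrt_partial N (sqrt_series x))
      \<longlonglongrightarrow> 0 + sqrt_series (sqrt_series x)"
    by (intro tendsto_add sqrt_partial_tendsto)
  moreover have "sqrt_partial N (sqrt_partial N x - sqrt_series x) + sqrt_partial N (sqrt_series x) =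
      sqrt_partial N (sqrt_partial N x)" for N
    using linear_diff[OF bounded_linear.linear[OF bounded_clinear_imp_bounded_linear[OF bounded_clinear_sqrt_partial]]]
    by simp
  ultimately show ?thesis using lim1 LIMSEQ_unique by fastforce
qed

lemma sqrt_series_commute:
  assumes T: "bounded_linear T" and comm: "\<And>x. T (Z x) = Z (T x)"
  shows "T (sqrt_series x) = sqrt_series (T x)"
proof -
  interpret T: bounded_linear T by fact
  have "T ((Z ^^ n) x) = (Z ^^ n) (T x)" for n by (induction n) (simp_all add: comm)
  then show ?thesis
    unfolding sqrt_series_def T.suminf[OF summable_sqrt_series] by (simp add: T.scaleR)
qed

text \<open>All coefficients but the first are nonpositive and \<open>\<langle>x, Z\<^sup>n x\<rangle> \<le> \<parallel>x\<parallel>\<^sup>2\<close>, so the form of a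
  partial sum at \<open>x\<close> is at least \<open>\<parallel>x\<parallel>\<^sup>2\<close> times the partial sum of the coefficients.\<close>

lemma positive_op_sqrt_series:
  assumes sym: "\<And>x y. cinner (Z x) y = cinner x (Z y)"
  shows "positive_op sqrt_series"
  unfolding positive_op_def
proof (intro conjI allI bounded_clinear_sqrt_series)
  fix x
  have symn: "cinner ((Z ^^ n) u) v = cinner u ((Z ^^ n) v)" for n u v
    by (induction n arbitrary: u v) (simp_all add: sym funpow_swap1)
  have real: "Im (cinner x ((Z ^^ n) x)) = 0" for n
    using cinner_commute[of x "(Z ^^ n) x"] by (simp add: symn complex_eq_iff)
  have lim: "(\<lambda>N. cinner x (sqrt_partial N x)) \<longlonglongrightarrow> cinner x (sqrt_series x)"
    by (intro cinner.tendsto tendsto_const sqrt_partial_tendsto)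
  have part: "cinner x (sqrt_partial N x) = (\<Sum>n<N. of_real (sqrt_coeff n) * cinner x ((Z ^^ n) x))" for N
    by (simp add: sqrt_partial_def cinner.sum_right cinner_scaleR_right)
  have "Im (cinner x (sqrt_partial N x)) = 0" for N unfolding part by (simp add: real)
  then have 1: "Im (cinner x (sqrt_series x)) = 0"
    using tendsto_Im[OF lim] by (simp add: LIMSEQ_const_iff)
  have "0 \<le> Re (cinner x (sqrt_partial N x))" for N
  proof -
    have "0 \<le> (\<Sum>n<N. sqrt_coeff n) * (norm x)\<^sup>2"
      by (intro mult_nonneg_nonneg sqrt_coeff_partial_sum_nonneg) simp
    also have "\<dots> \<le> (\<Sum>n<N. sqrt_coeff n * Re (cinner x ((Z ^^ n) x)))"
      unfolding sum_distrib_right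
    proof (rule sum_mono)
      fix n
      show "sqrt_coeff n * (norm x)\<^sup>2 \<le> sqrt_coeff n * Re (cinner x ((Z ^^ n) x))"
      proof (cases "n = 0")
        case False
        have "Re (cinner x ((Z ^^ n) x)) \<le> norm x * norm ((Z ^^ n) x)"
          using complex_Re_le_cmod Cauchy_Schwarz order_trans by blast
        also have "\<dots> \<le> norm x * norm x" by (intro mult_left_mono norm_funpow_contraction) simp
        finally show ?thesis
          using False sqrt_coeff_nonpos[of n] by (intro mult_left_mono_neg) (auto simp: power2_eq_square)
      qed (simp add: cinner_self)
    qed
    finally show ?thesis unfolding part by simp
  qed
  then have "0 \<le> Re (cinner x (sqrt_series x))"
    by (intro LIMSEQ_le_const[OF tendsto_Re[OF lim]]) auto
  with 1 show "cinner x (sqrt_series x) \<in> \<real>\<^sub>\<ge>\<^sub>0" by (simp add: complex_nonneg_Reals_iff)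
qed

end

text \<open>Uniqueness: a second root \<open>R\<close> commutes with \<open>A = R\<^sup>2\<close>, hence with the root \<open>B\<close> given by the
  series. For \<open>y = (B - R) x\<close> this gives \<open>\<langle>y, B y\<rangle> + \<langle>y, R y\<rangle> = \<langle>y, (B\<^sup>2 - R\<^sup>2) x\<rangle> = 0\<close>, so
  \<open>B y = R y = 0\<close> and \<open>\<parallel>y\<parallel>\<^sup>2 = \<langle>x, (B - R) y\<rangle> = 0\<close>.\<close>

lemma sqrt_op:
  assumes A: "positive_op A" and le: "\<And>x. Re (cinner x (A x)) \<le> (norm x)\<^sup>2"
  shows positive_op_sqrt_op: "positive_op (sqrt_op A)"
    and sqrt_op_square: "sqrt_op A (sqrt_op A x) = A x"
proof -
  define Z where "Z x = x - A x" for x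
  interpret A: bounded_linear A
    by (rule bounded_clinear_imp_bounded_linear) (rule positive_op_bounded_clinear[OF A])
  have Zlin: "bounded_clinear Z"
    unfolding Z_def [abs_def]
    by (intro bounded_clinear_diff bounded_clinear_id positive_op_bounded_clinear A)
  have Zx: "cinner x (Z x) = of_real ((norm x)\<^sup>2 - Re (cinner x (A x)))" for x
    using positive_op_real[OF A, of x] by (simp add: Z_def cinner.diff_right cinner_self)
  have Z: "positive_op Z"
    unfolding positive_op_def using Zlin Zx le by (simp add: complex_nonneg_Reals_iff)
  have Zc: "norm (Z x) \<le> norm x" for x
    by (rule positive_op_contraction[OF Z]) (simp add: Zx positive_op_nonneg[OF A])
  define B where "B = sqrt_series Z"
  have B: "positive_op B"
    unfolding B_def by (rule positive_op_sqrt_series[OF Zlin Zc positive_op_selfadjoint[OF Z]])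
  have BB: "B (B x) = A x" for x
    unfolding B_def by (simp add: sqrt_series_square[OF Zlin Zc]) (simp add: Z_def)
  have "sqrt_op A = B"
    unfolding sqrt_op_def
  proof (rule the_equality)
    show "positive_op B \<and> B \<circ> B = A" using B BB by (simp add: fun_eq_iff)
    fix R assume "positive_op R \<and> R \<circ> R = A"
    then have R: "positive_op R" and RR: "\<And>x. R (R x) = A x" by (auto simp: fun_eq_iff)
    have "bounded_linear R" "bounded_linear B"
      by (intro bounded_clinear_imp_bounded_linear positive_op_bounded_clinear R B)+
    then interpret R: bounded_linear R + B: bounded_linear B by simp_all
    have comm: "R (B x) = B (R x)" for x
      unfolding B_def
      by (rule sqrt_series_commute[OF Zlin Zc R.bounded_linear_axioms])
        (simp add: Z_def R.diff RR[symmetric])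
    show "R = B"
    proof
      fix x
      define y where "y = B x - R x"
      have "B y + R y = 0" unfolding y_def by (simp add: B.diff R.diff comm BB RR)
      then have "cinner y (B y) + cinner y (R y) = 0" by (simp add: cinner.zero_right flip: cinner_add_right)
      moreover have "0 \<le> Re (cinner y (B y))" "0 \<le> Re (cinner y (R y))"
        by (intro positive_op_nonneg B R)+
      ultimately have "Re (cinner y (B y)) = 0" "Re (cinner y (R y)) = 0"
        by (simp_all add: complex_eq_iff)
      then have "B y = 0" "R y = 0"
        using positive_op_eq_0[OF B] positive_op_eq_0[OF R] positive_op_real[OF B, of y]
          positive_op_real[OF R, of y] by simp_all
      then have "cinner y y = 0"
        unfolding y_def
        by (simp add: cinner.diff_left positive_op_selfadjoint[OF B] positive_op_selfadjoint[OF R])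
      then show "R x = B x" by (simp add: cinner_self_eq_zero_iff y_def)
    qed
  qed
  with B BB show "positive_op (sqrt_op A)" "sqrt_op A (sqrt_op A x) = A x" by simp_all
qed

section \<open>Cylinder sets\<close>

text \<open>The words of length \<open>n\<close>.\<close>

definition words :: "nat \<Rightarrow> nat \<Rightarrow> nat list set" where
  "words m n = {w \<in> lists {..<m}. length w = n}"

lemma finite_words [simp]: "finite (words m n)"
proof -
  have "words m n = {w. set w \<subseteq> {..<m} \<and> length w = n}" by (auto simp: words_def)
  then show ?thesis using finite_lists_length_eq[of "{..<m}" n] by simp
qed

lemma wordsD: "w \<in> words m n \<Longrightarrow> w \<in> lists {..<m}" "w \<in> words m n \<Longrightarrow> length w = n"
  by (simp_all add: words_def)

lemma sum_words_Suc: "(\<Sum>w\<in>words m (Suc n). f w) = (\<Sum>w\<in>words m n. \<Sum>j<m. f (w @ [j]))"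
proof -
  have "(\<Sum>(w, j)\<in>words m n \<times> {..<m}. f (w @ [j])) = (\<Sum>w\<in>words m (Suc n). f w)"
  proof (rule sum.reindex_bij_witness[where i = "\<lambda>w. (butlast w, last w)" and j = "\<lambda>(w, j). w @ [j]"])
    fix w assume w: "w \<in> words m (Suc n)"
    then have "w \<noteq> []" by (auto simp: words_def)
    with w show "(case (butlast w, last w) of (w, j) \<Rightarrow> w @ [j]) = w"
      "(butlast w, last w) \<in> words m n \<times> {..<m}"
      by (auto simp: words_def dest: in_set_butlastD)
  qed (auto simp: words_def)
  then show ?thesis by (simp add: sum.cartesian_product)
qed

lemma space_Omega: "space (Omega m) = {x. \<forall>i. x i < m}"
  by (auto simp: Omega_def space_PiM PiE_def Pi_def)

lemma cylinder_Nil: "cylinder m [] = space (Omega m)"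
  by (simp add: cylinder_def)

lemma cylinder_measurable [measurable, simp]: "cylinder m w \<in> sets (Omega m)"
proof -
  have "{x \<in> space (Omega m). x i = a} \<in> sets (Omega m)" for i a
  proof -
    have "(\<lambda>x. x i) \<in> measurable (Omega m) (count_space {..<m})"
      unfolding Omega_def by (rule measurable_component_singleton) simp
    then have "(\<lambda>x. x i) -` ({a} \<inter> {..<m}) \<inter> space (Omega m) \<in> sets (Omega m)"
      by (rule measurable_sets) simp
    also have "(\<lambda>x. x i) -` ({a} \<inter> {..<m}) \<inter> space (Omega m) = {x \<in> space (Omega m). x i = a}"
      by (auto simp: space_Omega)
    finally show ?thesis .
  qed
  note * = this
  have "{x \<in> space (Omega m). \<forall>i\<in>{..<length w}. x i = w ! i} \<in> sets (Omega m)"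
    by (rule sets.sets_Collect_finite_All) (rule *, rule finite_lessThan)
  then show ?thesis unfolding cylinder_def Ball_def lessThan_iff .
qed

lemma mem_cylinder_snoc: "x \<in> cylinder m (w @ [j]) \<longleftrightarrow> x \<in> cylinder m w \<and> x (length w) = j"
  by (auto simp: cylinder_def nth_append less_Suc_eq)

lemma cylinder_snoc:
  "cylinder m w = (\<Union>j<m. cylinder m (w @ [j]))"
  "disjoint_family_on (\<lambda>j. cylinder m (w @ [j])) {..<m}"
proof -
  have "x (length w) < m" if "x \<in> cylinder m w" for x
    using that by (simp add: cylinder_def space_Omega)
  then show "cylinder m w = (\<Union>j<m. cylinder m (w @ [j]))" by (auto simp: mem_cylinder_snoc)
  show "disjoint_family_on (\<lambda>j. cylinder m (w @ [j])) {..<m}"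
    by (auto simp: disjoint_family_on_def mem_cylinder_snoc)
qed

lemma cylinder_words:
  "space (Omega m) = (\<Union>w\<in>words m n. cylinder m w)"
  "disjoint_family_on (cylinder m) (words m n)"
proof -
  have "x \<in> cylinder m (map x [0..<n]) \<and> map x [0..<n] \<in> words m n" if "x \<in> space (Omega m)" for x
    using that by (auto simp: cylinder_def words_def space_Omega)
  then show "space (Omega m) = (\<Union>w\<in>words m n. cylinder m w)"
    unfolding cylinder_def by blast
  show "disjoint_family_on (cylinder m) (words m n)"
    by (force simp: disjoint_family_on_def words_def cylinder_def intro: nth_equalityI)
qed

lemma cylinder_Int:
  assumes "length v \<le> length w"
  shows "cylinder m v \<inter> cylinder m w = (if take (length v) w = v then cylinder m w else {})"
proof (cases "take (length v) w = v")
  case True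
  then have "v ! i = w ! i" if "i < length v" for i using that by (metis nth_take)
  then show ?thesis using True assms by (auto simp: cylinder_def)
next
  case False
  then obtain i where "i < length v" "take (length v) w ! i \<noteq> v ! i"
    using assms by (metis length_take min.absorb2 nth_equalityI)
  then show ?thesis using False assms by (auto simp: cylinder_def)
qed

text \<open>The cylinder sets of all words. The empty set is added to make the family stable under
  intersections.\<close>

definition cylinders :: "nat \<Rightarrow> (nat \<Rightarrow> nat) set set" where
  "cylinders m = insert {} (cylinder m ` lists {..<m})"

lemma Int_stable_cylinders: "Int_stable (cylinders m)"
proof (rule Int_stableI)
  fix A B assume "A \<in> cylinders m" "B \<in> cylinders m"
  moreover have "cylinder m v \<inter> cylinder m w \<in> cylinders m"
    if "v \<in> lists {..<m}" "w \<in> lists {..<m}" for v w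
  proof (cases "length v \<le> length w")
    case True
    then show ?thesis using that by (auto simp: cylinder_Int cylinders_def)
  next
    case False
    then show ?thesis
      using that cylinder_Int[of w v m] by (auto simp: Int_commute cylinders_def)
  qed
  ultimately show "A \<inter> B \<in> cylinders m" by (auto simp: cylinders_def)
qed

lemma sets_Omega: "sets (Omega m) = sigma_sets (space (Omega m)) (cylinders m)"
proof
  let ?S = "sigma_sets (space (Omega m)) (cylinders m)"
  have sub: "cylinders m \<subseteq> Pow (space (Omega m))" by (auto simp: cylinders_def cylinder_def)
  interpret S: sigma_algebra "space (Omega m)" ?S by (rule sigma_algebra_sigma_sets) (rule sub)
  have gen: "{x \<in> space (Omega m). x i \<in> A} \<in> ?S" for i A
  proof -
    have "{x \<in> space (Omega m). x i \<in> A} = (\<Union>w\<in>{w \<in> words m (Suc i). w ! i \<in> A}. cylinder m w)"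
      unfolding cylinder_words(1)[of m "Suc i"] by (auto simp: cylinder_def words_def)
    also have "\<dots> \<in> ?S"
    proof (intro S.finite_UN)
      show "finite {w \<in> words m (Suc i). w ! i \<in> A}" by simp
    qed (auto simp: cylinders_def words_def intro!: sigma_sets.Basic)
    finally show ?thesis .
  qed
  have sp: "(\<Pi>\<^sub>E i\<in>UNIV. space (count_space {..<m})) = space (Omega m)"
    by (simp add: Omega_def space_PiM)
  show "sets (Omega m) \<subseteq> ?S"
    by (subst Omega_def, subst sets_PiM_single, unfold sp)
      (intro S.sigma_sets_subset, use gen in auto)
  show "?S \<subseteq> sets (Omega m)"
    by (rule sets.sigma_sets_subset) (auto simp: cylinders_def)
qed

text \<open>The \<open>\<pi>\<close>-\<open>\<lambda>\<close> theorem for the cylinder sets.\<close>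

lemma sets_Omega_induct [consumes 1, case_names cylinder empty compl union]:
  assumes "A \<in> sets (Omega m)"
    and "\<And>w. w \<in> lists {..<m} \<Longrightarrow> P (cylinder m w)"
    and "P {}"
    and "\<And>A. A \<in> sets (Omega m) \<Longrightarrow> P A \<Longrightarrow> P (space (Omega m) - A)"
    and "\<And>A. disjoint_family A \<Longrightarrow> range A \<subseteq> sets (Omega m) \<Longrightarrow> (\<And>i. P (A i)) \<Longrightarrow> P (\<Union>i::nat. A i)"
  shows "P A"
proof (rule sigma_sets_induct_disjoint[OF Int_stable_cylinders])
  show "cylinders m \<subseteq> Pow (space (Omega m))" by (auto simp: cylinders_def cylinder_def)
  show "A \<in> sigma_sets (space (Omega m)) (cylinders m)" using assms(1) by (simp add: sets_Omega)
  show "P A" if "A \<in> cylinders m" for A using that assms(2,3) by (auto simp: cylinders_def)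
  show "P (space (Omega m) - A)" if "A \<in> sigma_sets (space (Omega m)) (cylinders m)" "P A" for A
    using that unfolding sets_Omega[symmetric] by (rule assms(4))
  show "P (\<Union>i::nat. A i)"
    if "disjoint_family A" "range A \<subseteq> sigma_sets (space (Omega m)) (cylinders m)" "\<And>i. P (A i)"
    for A using that unfolding sets_Omega[symmetric] by (rule assms(5))
qed (rule assms(3))

section \<open>Extension of a bounded additive function on words\<close>

text \<open>An additive function \<open>g\<close> on words that is dominated by a finite measure \<open>M\<close> is the
  restriction to cylinders of a signed measure dominated by \<open>M\<close>. On the set \<open>A\<close> the latter is the
  limit of the integrals over \<open>A\<close> of the step functions with value \<open>g w / M [w]\<close> on \<open>[w]\<close>, where
  \<open>w\<close> has length \<open>n\<close>. Where \<open>M [w] = 0\<close> also \<open>g w = 0\<close>, and the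
  quotient is \<open>0\<close>. By domination, the sets for which the limit exists form a Dynkin system.\<close>

lemma signed_measure_extension:
  fixes M :: "(nat \<Rightarrow> nat) measure" and g :: "nat list \<Rightarrow> real"
  assumes "finite_measure M" and sets_M: "sets M = sets (Omega m)"
    and add: "\<And>w. w \<in> lists {..<m} \<Longrightarrow> g w = (\<Sum>j<m. g (w @ [j]))"
    and dom: "\<And>w. w \<in> lists {..<m} \<Longrightarrow> \<bar>g w\<bar> \<le> measure M (cylinder m w)"
  obtains G where "\<And>w. w \<in> lists {..<m} \<Longrightarrow> G (cylinder m w) = g w"
    "\<And>A. A \<in> sets (Omega m) \<Longrightarrow> \<bar>G A\<bar> \<le> measure M A"
    "\<And>A. disjoint_family A \<Longrightarrow> range A \<subseteq> sets (Omega m) \<Longrightarrow>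
      (\<lambda>n::nat. G (A n)) sums G (\<Union>n. A n)"
proof -
  interpret finite_measure M by fact
  have space_M: "space M = space (Omega m)" using sets_M by (rule sets_eq_imp_space_eq)
  define Gn where
    "Gn n A = (\<Sum>w\<in>words m n. g w / measure M (cylinder m w) * measure M (A \<inter> cylinder m w))" for n A
  have Gn_sums: "(\<lambda>i. Gn n (A i)) sums Gn n (\<Union>i. A i)"
    if "disjoint_family A" "range A \<subseteq> sets (Omega m)" for n and A :: "nat \<Rightarrow> _"
    unfolding Gn_def
  proof (intro sums_sum sums_mult)
    fix w
    have "(\<lambda>i. measure M (A i \<inter> cylinder m w)) sums measure M (\<Union>i. A i \<inter> cylinder m w)"
      using that by (intro finite_measure_UNION) (auto simp: sets_M disjoint_family_on_def)
    then show "(\<lambda>i. measure M (A i \<inter> cylinder m w)) sums measure M ((\<Union>i. A i) \<inter> cylinder m w)"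
      by simp
  qed
  have Gn_dom: "\<bar>Gn n A\<bar> \<le> measure M A" if A: "A \<in> sets (Omega m)" for n A
  proof -
    have "\<bar>Gn n A\<bar> \<le> (\<Sum>w\<in>words m n. measure M (A \<inter> cylinder m w))"
      unfolding Gn_def
    proof (rule order_trans[OF sum_abs sum_mono])
      fix w assume "w \<in> words m n"
      then have "\<bar>g w\<bar> \<le> measure M (cylinder m w)" using dom wordsD by blast
      then have "\<bar>g w / measure M (cylinder m w)\<bar> \<le> 1"
        using zero_less_measure_iff[of M "cylinder m w"] by (simp add: divide_le_eq_1 abs_divide)
      then show "\<bar>g w / measure M (cylinder m w) * measure M (A \<inter> cylinder m w)\<bar>
          \<le> measure M (A \<inter> cylinder m w)"
        by (simp only: abs_mult abs_of_nonneg[OF measure_nonneg] mult_left_le_one_le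
            measure_nonneg abs_ge_zero)
    qed
    also have "\<dots> = measure M (\<Union>w\<in>words m n. A \<inter> cylinder m w)"
      using A cylinder_words(2)[of m n]
      by (intro finite_measure_finite_Union[symmetric]) (auto simp: sets_M disjoint_family_on_def)
    also have "(\<Union>w\<in>words m n. A \<inter> cylinder m w) = A"
      using cylinder_words(1)[of m n] sets.sets_into_space[OF A] by blast
    finally show ?thesis .
  qed
  have Gn_cylinder: "Gn n (cylinder m v) = g v" if v: "v \<in> lists {..<m}" "length v \<le> n" for n v
  proof -
    have "Gn n (cylinder m v) = (\<Sum>w\<in>words m n. if take (length v) w = v then g w else 0)"
      unfolding Gn_def
    proof (intro sum.cong refl)
      fix w assume "w \<in> words m n"
      then have w: "length v \<le> length w" "\<bar>g w\<bar> \<le> measure M (cylinder m w)"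
        using dom wordsD v by blast+
      then show "g w / measure M (cylinder m w) * measure M (cylinder m v \<inter> cylinder m w) =
          (if take (length v) w = v then g w else 0)"
        by (cases "measure M (cylinder m w) = 0") (auto simp: cylinder_Int)
    qed
    also have "\<dots> = g v"
      using v(2)
    proof (induction n rule: dec_induct)
      case base
      have "(\<Sum>w\<in>words m (length v). if take (length v) w = v then g w else 0) =
          (\<Sum>w\<in>words m (length v). if w = v then g v else 0)"
        by (intro sum.cong) (auto simp: words_def)
      also have "v \<in> words m (length v)" using v by (simp add: words_def)
      then have "(\<Sum>w\<in>words m (length v). if w = v then g v else 0) = g v" by simp
      finally show ?case .
    next
      case (step n)
      have "(\<Sum>w\<in>words m (Suc n). if take (length v) w = v then g w else 0) =
          (\<Sum>w\<in>words m n. \<Sum>j<m. if take (length v) w = v then g (w @ [j]) else 0)"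
        unfolding sum_words_Suc using step(1) by (intro sum.cong) (auto simp: words_def)
      also have "\<dots> = (\<Sum>w\<in>words m n. if take (length v) w = v then g w else 0)"
        by (intro sum.cong refl) (use add wordsD in auto)
      finally show ?case using step.IH by simp
    qed
    finally show ?thesis .
  qed
  define G where "G A = lim (\<lambda>n. Gn n A)" for A
  have G_cylinder: "(\<lambda>n. Gn n (cylinder m w)) \<longlonglongrightarrow> g w" if "w \<in> lists {..<m}" for w
    by (rule tendsto_eventually)
      (use Gn_cylinder that in \<open>auto simp: eventually_sequentially\<close>)
  \<comment> \<open>Domination by the summable masses \<open>M (A i)\<close> allows the limit in \<open>n\<close> to be taken termwise.\<close>
  have tannery: "(\<lambda>n. Gn n (\<Union>i. A i)) \<longlonglongrightarrow> (\<Sum>i. G (A i)) \<and> summable (\<lambda>i. G (A i))"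
    if A: "disjoint_family A" "range A \<subseteq> sets (Omega m)"
      and conv: "\<And>i. convergent (\<lambda>n. Gn n (A i))" for A :: "nat \<Rightarrow> _"
  proof -
    have "eventually (\<lambda>n. summable (\<lambda>k. norm (Gn n (A k)))) sequentially \<and>
        summable (\<lambda>k. norm (G (A k))) \<and>
        (\<lambda>n. \<Sum>k. Gn n (A k)) \<longlonglongrightarrow> (\<Sum>k. G (A k))"
    proof (rule tannerys_theorem[where M = "\<lambda>k. measure M (A k)"])
      show "(\<lambda>n. Gn n (A k)) \<longlonglongrightarrow> G (A k)" for k
        using conv[of k] by (simp add: convergent_LIMSEQ_iff G_def)
      show "\<forall>\<^sub>F (k, n) in at_top \<times>\<^sub>F sequentially. norm (Gn n (A k)) \<le> measure M (A k)"
        by (rule always_eventually) (use A(2) Gn_dom in auto)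
      show "summable (\<lambda>k. measure M (A k))"
        using finite_measure_UNION[of A] A by (auto simp: sets_M sums_iff)
    qed simp
    then show ?thesis
      using sums_unique[OF Gn_sums[OF A]] summable_norm_cancel[of "\<lambda>k. G (A k)"] by auto
  qed
  have conv: "convergent (\<lambda>n. Gn n A)" if "A \<in> sets (Omega m)" for A
    using that
  proof (induction rule: sets_Omega_induct)
    case (cylinder w)
    then show ?case using G_cylinder convergent_def by blast
  next
    case empty
    show ?case by (simp add: Gn_def convergent_const)
  next
    case (compl A)
    have "Gn n (space (Omega m) - A) = Gn n (space (Omega m)) - Gn n A" for n
    proof -
      have "measure M ((space (Omega m) - A) \<inter> cylinder m w) =
          measure M (space (Omega m) \<inter> cylinder m w) - measure M (A \<inter> cylinder m w)" for w
      proof -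
        have "(space (Omega m) - A) \<inter> cylinder m w =
            (space (Omega m) \<inter> cylinder m w) - (A \<inter> cylinder m w)" by blast
        moreover have "A \<inter> cylinder m w \<subseteq> space (Omega m) \<inter> cylinder m w"
          using sets.sets_into_space[OF compl(1)] by blast
        ultimately show ?thesis
          using compl(1) by (simp only:) (rule finite_measure_Diff, auto simp: sets_M)
      qed
      then show ?thesis by (simp add: Gn_def right_diff_distrib sum_subtractf)
    qed
    moreover have "convergent (\<lambda>n. Gn n (space (Omega m)))"
      using G_cylinder[of "[]"] by (auto simp: cylinder_Nil convergent_def)
    ultimately show ?case using compl(2) by (simp add: convergent_diff)
  next
    case (union A)
    then show ?case using tannery[of A] by (auto simp: convergent_def)
  qed
  show ?thesis
  proof
    show "G (cylinder m w) = g w" if "w \<in> lists {..<m}" for w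
      unfolding G_def by (rule limI) (rule G_cylinder[OF that])
    show "\<bar>G A\<bar> \<le> measure M A" if "A \<in> sets (Omega m)" for A
    proof (rule LIMSEQ_le_const2)
      show "(\<lambda>n. \<bar>Gn n A\<bar>) \<longlonglongrightarrow> \<bar>G A\<bar>"
        using conv[OF that] by (intro tendsto_rabs) (simp add: convergent_LIMSEQ_iff G_def)
    qed (use Gn_dom that in auto)
    show "(\<lambda>n. G (A n)) sums G (\<Union>n. A n)"
      if A: "disjoint_family A" "range A \<subseteq> sets (Omega m)" for A :: "nat \<Rightarrow> _"
    proof -
      have t: "(\<lambda>n. Gn n (\<Union>i. A i)) \<longlonglongrightarrow> (\<Sum>i. G (A i))" "summable (\<lambda>i. G (A i))"
        using tannery[OF A] conv A(2) by blast+
      then have "G (\<Union>i. A i) = (\<Sum>i. G (A i))" unfolding G_def by (intro limI)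
      with t(2) show ?thesis by (simp add: summable_sums)
    qed
  qed
qed

section \<open>Weak limits of operators\<close>

lemma cinner_eqI_right: "(\<And>x. cinner x y = cinner x y') \<Longrightarrow> y = y'"
  by (metis cinner_commute cinner_eqI)

text \<open>A pointwise limit of quadratic forms of bounded operators, if bounded, is again the quadratic
  form of a bounded operator.\<close>

lemma weak_limit_operator:
  fixes T :: "nat \<Rightarrow> 'a::complex_hilbert_space \<Rightarrow> 'a" and Q :: "'a \<Rightarrow> complex"
  assumes T: "\<And>n. bounded_clinear (T n)"
    and lim: "\<And>x. (\<lambda>n. cinner x (T n x)) \<longlonglongrightarrow> Q x"
    and bd: "\<And>x. cmod (Q x) \<le> K * (norm x)\<^sup>2"
  obtains L where "bounded_clinear L" "\<And>x. cinner x (L x) = Q x"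
proof -
  \<comment> \<open>The polarization of \<open>Q\<close> is the limit of the sesquilinear forms of the operators \<open>T n\<close>.\<close>
  define B where "B x y =
    (Q (x + y) - Q (x - y) - \<i> * Q (x + \<i> *\<^sub>C y) + \<i> * Q (x - \<i> *\<^sub>C y)) / 4" for x y
  have limB: "(\<lambda>n. cinner x (T n y)) \<longlonglongrightarrow> B x y" for x y
  proof -
    have "(\<lambda>n. (cinner (x + y) (T n (x + y)) - cinner (x - y) (T n (x - y))
       - \<i> * cinner (x + \<i> *\<^sub>C y) (T n (x + \<i> *\<^sub>C y))
       + \<i> * cinner (x - \<i> *\<^sub>C y) (T n (x - \<i> *\<^sub>C y))) / 4) \<longlonglongrightarrow> B x y"
      unfolding B_def by (intro tendsto_intros lim) simp
    then show ?thesis by (simp only: polarization[OF T, symmetric])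
  qed
  have Tlin: "T n (x + y) = T n x + T n y" "T n (c *\<^sub>C x) = c *\<^sub>C T n x" for n x y c
    using bounded_clinear_onD(2,3)[OF T] by auto
  have B_add_left: "B (x + x') y = B x y + B x' y" for x x' y
    by (rule LIMSEQ_unique[OF limB]) (simp add: cinner_add_left tendsto_add limB)
  have B_add_right: "B x (y + y') = B x y + B x y'" for x y y'
    by (rule LIMSEQ_unique[OF limB]) (simp add: Tlin cinner_add_right tendsto_add limB)
  have B_scale_left: "B (c *\<^sub>C x) y = cnj c * B x y" for c x y
    by (rule LIMSEQ_unique[OF limB]) (simp add: cinner_scaleC_left tendsto_mult limB)
  have B_scale_right: "B x (c *\<^sub>C y) = c * B x y" for c x y
    by (rule LIMSEQ_unique[OF limB]) (simp add: Tlin cinner_scaleC_right tendsto_mult limB)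
  have B_diag: "B x x = Q x" for x
    using LIMSEQ_unique[OF limB lim] .
  have K: "0 \<le> K" if "x \<noteq> 0" for x :: 'a
    using order_trans[OF norm_ge_zero bd[of x]] that by (simp add: zero_le_mult_iff)
  have B_unit: "cmod (B u v) \<le> 4 * K" if "norm u = 1" "norm v = 1" for u v
  proof -
    have "u \<noteq> 0" using that by auto
    have q: "cmod (Q z) \<le> 4 * K" if "norm z \<le> 2" for z
    proof -
      have "(norm z)\<^sup>2 \<le> 2\<^sup>2" using that by (rule power_mono) simp
      then have "K * (norm z)\<^sup>2 \<le> K * 4" using K[OF \<open>u \<noteq> 0\<close>] by (intro mult_left_mono) auto
      with bd[of z] show ?thesis by simp
    qed
    have n: "norm (u + v) \<le> 2" "norm (u - v) \<le> 2" "norm (u + \<i> *\<^sub>C v) \<le> 2" "norm (u - \<i> *\<^sub>C v) \<le> 2"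
      using norm_triangle_ineq[of u v] norm_triangle_ineq4[of u v]
        norm_triangle_ineq[of u "\<i> *\<^sub>C v"] norm_triangle_ineq4[of u "\<i> *\<^sub>C v"] that
      by (simp_all add: norm_scaleC)
    have "cmod (Q (u + v) - Q (u - v) - \<i> * Q (u + \<i> *\<^sub>C v) + \<i> * Q (u - \<i> *\<^sub>C v)) \<le>
        cmod (Q (u + v)) + cmod (Q (u - v)) + cmod (\<i> * Q (u + \<i> *\<^sub>C v)) + cmod (\<i> * Q (u - \<i> *\<^sub>C v))"
      by (intro order_trans[OF norm_triangle_ineq] add_right_mono order_trans[OF norm_triangle_ineq4])
        simp
    also have "\<dots> \<le> 4 * K + 4 * K + 4 * K + 4 * K"
      by (simp only: norm_mult norm_ii mult_1_left) (intro add_mono q n)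
    finally show ?thesis by (simp add: B_def norm_divide)
  qed
  have B_bound: "cmod (B x y) \<le> 4 * K * norm y * norm x" for x y
  proof (cases "x = 0 \<or> y = 0")
    case True
    then show ?thesis using B_scale_left[of 0 0 y] B_scale_right[of x 0 0] by auto
  next
    case False
    define u where "u = (1 / norm x) *\<^sub>R x"
    define v where "v = (1 / norm y) *\<^sub>R y"
    have "x = complex_of_real (norm x) *\<^sub>C u" "y = complex_of_real (norm y) *\<^sub>C v"
      using False by (simp_all add: u_def v_def flip: scaleR_scaleC)
    then have "B x y = of_real (norm x) * (of_real (norm y) * B u v)"
      by (metis B_scale_left B_scale_right complex_cnj_complex_of_real)
    then have "cmod (B x y) = norm x * (norm y * cmod (B u v))" by (simp add: norm_mult)
    also have "\<dots> \<le> norm x * (norm y * (4 * K))"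
      using False by (intro mult_left_mono B_unit) (simp_all add: u_def v_def)
    finally show ?thesis by (simp add: mult_ac)
  qed
  have "\<exists>z. \<forall>x. B x y = cinner x z" for y
  proof -
    obtain z where "\<And>x. x \<in> UNIV \<Longrightarrow> cnj (B x y) = cinner z x"
    proof (rule Riesz_seminorm[of UNIV "\<lambda>x. x" "\<lambda>x. cnj (B x y)" "4 * K * norm y"])
      show "cmod (cnj (B x y)) \<le> 4 * K * norm y * norm x" for x
        using B_bound by simp
    qed (auto simp: B_add_left B_scale_left)
    then have "B x y = cinner x z" for x
      by (metis UNIV_I cinner_commute complex_cnj_cnj)
    then show ?thesis by blast
  qed
  then obtain L where L: "\<And>x y. B x y = cinner x (L y)" by metis
  have "bounded_clinear L"
    unfolding bounded_clinear_on_def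
  proof (intro conjI ballI allI exI[of _ "4 * K"])
    show "L (x + y) = L x + L y" for x y
      by (rule cinner_eqI_right) (simp add: L[symmetric] cinner_add_right B_add_right)
    show "L (c *\<^sub>C x) = c *\<^sub>C L x" for c x
      by (rule cinner_eqI_right) (simp add: L[symmetric] cinner_scaleC_right B_scale_right)
    show "norm (L y) \<le> 4 * K * norm y" for y
    proof (cases "L y = 0")
      case False
      have "norm (L y) * norm (L y) \<le> 4 * K * norm y * norm (L y)"
        using B_bound[of "L y" y] by (simp add: L cinner_self power2_eq_square norm_mult)
      then show ?thesis using False by simp
    next
      case True
      then show ?thesis using K[of y] by (cases "y = 0") auto
    qed
  qed simp
  then show ?thesis using B_diag L by (intro that[of L]) auto
qed

section \<open>Scalar measures of a POVM\<close>

lemma POVMsD: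
  assumes "E \<in> POVMs M"
  shows POVM_positive: "A \<in> sets M \<Longrightarrow> positive_op (E A)"
    and POVM_sums: "disjoint_family B \<Longrightarrow> range B \<subseteq> sets M \<Longrightarrow>
      (\<lambda>n::nat. cinner x (E (B n) y)) sums cinner x (E (\<Union>n. B n) y)"
    and POVM_space: "E (space M) = id"
  using assms by (auto simp: POVMs_def)

text \<open>The finite measure \<open>A \<mapsto> \<langle>x, E A x\<rangle>\<close>.\<close>

definition povm_measure :: "'x measure \<Rightarrow> ('x set \<Rightarrow> 'a::complex_hilbert_space \<Rightarrow> 'a) \<Rightarrow> 'a \<Rightarrow> 'x measure" where
  "povm_measure M E x = measure_of (space M) (sets M) (\<lambda>A. ennreal (Re (cinner x (E A x))))"

lemma sets_povm_measure: "sets (povm_measure M E x) = sets M"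
  by (simp add: povm_measure_def)

lemma space_povm_measure: "space (povm_measure M E x) = space M"
  by (simp add: povm_measure_def)

lemma emeasure_povm_measure:
  assumes E: "E \<in> POVMs M" and A: "A \<in> sets M"
  shows "emeasure (povm_measure M E x) A = ennreal (Re (cinner x (E A x)))"
  unfolding povm_measure_def
proof (rule emeasure_measure_of_sigma)
  show "sigma_algebra (space M) (sets M)" by (rule sets.sigma_algebra_axioms)
  have "(\<lambda>n::nat. cinner x (E {} x)) sums cinner x (E {} x)"
    using POVM_sums[OF E, of "\<lambda>n. {}" x x] by (simp add: disjoint_family_on_def)
  then have "cinner x (E {} x) = 0" by (simp add: sums_iff summable_const_iff)
  then show "positive (sets M) (\<lambda>A. ennreal (Re (cinner x (E A x))))"
    by (simp add: positive_def)
  show "countably_additive (sets M) (\<lambda>A. ennreal (Re (cinner x (E A x))))"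
    unfolding countably_additive_def
  proof (intro allI impI)
    fix B :: "nat \<Rightarrow> _"
    assume B: "range B \<subseteq> sets M" "disjoint_family B" "\<Union> (range B) \<in> sets M"
    show "(\<Sum>i. ennreal (Re (cinner x (E (B i) x)))) = ennreal (Re (cinner x (E (\<Union> (range B)) x)))"
    proof (rule suminf_ennreal_eq)
      show "0 \<le> Re (cinner x (E (B i) x))" for i
        using B by (intro positive_op_nonneg POVM_positive[OF E]) auto
      show "(\<lambda>i. Re (cinner x (E (B i) x))) sums Re (cinner x (E (\<Union> (range B)) x))"
        by (intro sums_Re POVM_sums[OF E] B)
    qed
  qed
qed (rule A)

lemma measure_povm_measure:
  assumes "E \<in> POVMs M" and "A \<in> sets M"
  shows "measure (povm_measure M E x) A = Re (cinner x (E A x))"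
  using assms positive_op_nonneg[OF POVM_positive[OF assms]]
  by (simp add: measure_def emeasure_povm_measure)

lemma finite_measure_povm_measure:
  assumes "E \<in> POVMs M" shows "finite_measure (povm_measure M E x)"
  by (rule finite_measureI) (simp add: space_povm_measure emeasure_povm_measure[OF assms])

lemma POVM_le:
  assumes E: "E \<in> POVMs M" and A: "A \<in> sets M"
  shows "Re (cinner x (E A x)) \<le> (norm x)\<^sup>2"
proof -
  interpret finite_measure "povm_measure M E x" by (rule finite_measure_povm_measure) fact
  have "measure (povm_measure M E x) A \<le> measure (povm_measure M E x) (space M)"
    using bounded_measure[of A] by (simp add: space_povm_measure)
  then show ?thesis
    by (simp add: measure_povm_measure[OF E] A POVM_space[OF E] cinner_self)
qed

section \<open>Operator-valued extension\<close>

text \<open>An additive family of bounded operators \<open>F w\<close> on words whose quadratic forms are real and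
  dominated by those of \<open>E ([w])\<close> extends to an operator-valued measure. Its quadratic forms are the
  signed measures given by the scalar extension; that they come from operators is again
  proved by a Dynkin argument.\<close>

lemma operator_measure_extension:
  fixes F :: "nat list \<Rightarrow> 'a::complex_hilbert_space \<Rightarrow> 'a"
  assumes E: "E \<in> POVMs (Omega m)"
    and F: "\<And>w. w \<in> lists {..<m} \<Longrightarrow> bounded_clinear (F w)"
    and real: "\<And>w x. w \<in> lists {..<m} \<Longrightarrow> cinner x (F w x) \<in> \<real>"
    and add: "\<And>w x. w \<in> lists {..<m} \<Longrightarrow> cinner x (F w x) = (\<Sum>j<m. cinner x (F (w @ [j]) x))"
    and dom: "\<And>w x. w \<in> lists {..<m} \<Longrightarrow>
      \<bar>Re (cinner x (F w x))\<bar> \<le> Re (cinner x (E (cylinder m w) x))"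
  obtains T G where "\<And>A. A \<in> sets (Omega m) \<Longrightarrow> bounded_clinear (T A)"
    "\<And>A x. A \<in> sets (Omega m) \<Longrightarrow> cinner x (T A x) = complex_of_real (G x A)"
    "\<And>A x. A \<in> sets (Omega m) \<Longrightarrow> \<bar>G x A\<bar> \<le> Re (cinner x (E A x))"
    "\<And>A x. disjoint_family A \<Longrightarrow> range A \<subseteq> sets (Omega m) \<Longrightarrow>
      (\<lambda>n::nat. G x (A n)) sums G x (\<Union>n. A n)"
    "\<And>w. w \<in> lists {..<m} \<Longrightarrow> T (cylinder m w) = F w"
proof -
  have "\<exists>G. (\<forall>w\<in>lists {..<m}. G (cylinder m w) = Re (cinner x (F w x))) \<and>
      (\<forall>A\<in>sets (Omega m). \<bar>G A\<bar> \<le> Re (cinner x (E A x))) \<and>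
      (\<forall>A. disjoint_family A \<longrightarrow> range A \<subseteq> sets (Omega m) \<longrightarrow>
        (\<lambda>n::nat. G (A n)) sums G (\<Union>n. A n))" for x
  proof (rule signed_measure_extension[of "povm_measure (Omega m) E x" m "\<lambda>w. Re (cinner x (F w x))"])
    show "finite_measure (povm_measure (Omega m) E x)" by (rule finite_measure_povm_measure) fact
    show "Re (cinner x (F w x)) = (\<Sum>j<m. Re (cinner x (F (w @ [j]) x)))" if "w \<in> lists {..<m}" for w
      using add[OF that] by (simp only: Re_sum[symmetric])
    show "\<bar>Re (cinner x (F w x))\<bar> \<le> measure (povm_measure (Omega m) E x) (cylinder m w)"
      if "w \<in> lists {..<m}" for w
      using dom[OF that] by (simp add: measure_povm_measure[OF E])
    fix G
    assume "\<And>w. w \<in> lists {..<m} \<Longrightarrow> G (cylinder m w) = Re (cinner x (F w x))"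
      "\<And>A. A \<in> sets (Omega m) \<Longrightarrow> \<bar>G A\<bar> \<le> measure (povm_measure (Omega m) E x) A"
      "\<And>A. disjoint_family A \<Longrightarrow> range A \<subseteq> sets (Omega m) \<Longrightarrow>
        (\<lambda>n::nat. G (A n)) sums G (\<Union>n. A n)"
    then show ?thesis by (intro exI[of _ G]) (simp add: measure_povm_measure[OF E])
  qed (rule sets_povm_measure)
  then obtain G where
    G_cyl: "\<And>x w. w \<in> lists {..<m} \<Longrightarrow> G x (cylinder m w) = Re (cinner x (F w x))"
    and G_dom: "\<And>x A. A \<in> sets (Omega m) \<Longrightarrow> \<bar>G x A\<bar> \<le> Re (cinner x (E A x))"
    and G_sums: "\<And>x A. disjoint_family A \<Longrightarrow> range A \<subseteq> sets (Omega m) \<Longrightarrow>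
      (\<lambda>n::nat. G x (A n)) sums G x (\<Union>n. A n)"
    by metis
  have F_G: "cinner x (F w x) = complex_of_real (G x (cylinder m w))" if "w \<in> lists {..<m}" for x w
    using real[OF that, of x] G_cyl[OF that] by (simp add: complex_is_Real_iff complex_eq_iff)
  have G_empty: "G x {} = 0" for x
    using G_sums[of "\<lambda>n. {}" x]
    by (simp add: disjoint_family_on_def sums_iff summable_const_iff)
  have "\<exists>L. bounded_clinear L \<and> (\<forall>x. cinner x (L x) = complex_of_real (G x A))"
    if "A \<in> sets (Omega m)" for A
    using that
  proof (induction rule: sets_Omega_induct)
    case (cylinder w)
    then show ?case using F F_G by blast
  next
    case empty
    show ?case
      using bounded_clinear_zero by (intro exI[of _ "\<lambda>x. 0"]) (simp add: G_empty cinner.zero_right)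
  next
    case (compl A)
    then obtain L where L: "bounded_clinear L" "\<And>x. cinner x (L x) = complex_of_real (G x A)"
      by blast
    have "G x (space (Omega m) - A) = G x (space (Omega m)) - G x A" for x
    proof -
      have "(\<lambda>n. G x (binaryset A (space (Omega m) - A) n)) sums (G x A + G x (space (Omega m) - A))"
        by (rule binaryset_sums) (rule G_empty)
      moreover have "(\<lambda>n. G x (binaryset A (space (Omega m) - A) n)) sums
          G x (\<Union>n. binaryset A (space (Omega m) - A) n)"
        using compl(1)
        by (intro G_sums) (auto simp: disjoint_family_on_def binaryset_def)
      moreover have "(\<Union>n. binaryset A (space (Omega m) - A) n) = space (Omega m)"
        using sets.sets_into_space[OF compl(1)] by (auto simp: UN_binaryset_eq)
      ultimately show ?thesis by (simp add: sums_iff)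
    qed
    then have "cinner x (F [] x - L x) = complex_of_real (G x (space (Omega m) - A))" for x
      using F_G[of "[]" x] by (simp add: cinner.diff_right L cylinder_Nil)
    then show ?case using F[of "[]"] L(1) by (intro exI[of _ "\<lambda>x. F [] x - L x"]) (auto intro: bounded_clinear_diff)
  next
    case (union A)
    then obtain L where L: "\<And>n. bounded_clinear (L n)"
      "\<And>n x. cinner x (L n x) = complex_of_real (G x (A n))" by metis
    have bd: "cmod (complex_of_real (G x (\<Union>n. A n))) \<le> 1 * (norm x)\<^sup>2" for x
    proof -
      have "(\<Union>n. A n) \<in> sets (Omega m)" using union(2) by auto
      then show ?thesis using order_trans[OF G_dom POVM_le[OF E]] by simp
    qed
    have lim: "(\<lambda>N. cinner x (\<Sum>n<N. L n x)) \<longlonglongrightarrow> complex_of_real (G x (\<Union>n. A n))" for x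
      using sums_of_real[OF G_sums[OF union(1,2), of x], where 'a = complex]
      by (simp add: sums_def cinner.sum_right L)
    obtain L' where "bounded_clinear L'" "\<And>x. cinner x (L' x) = complex_of_real (G x (\<Union>n. A n))"
      by (rule weak_limit_operator[OF bounded_clinear_sum[OF L(1)] lim bd]) (rule that)
    then show ?case by blast
  qed
  then obtain T where T: "\<And>A. A \<in> sets (Omega m) \<Longrightarrow> bounded_clinear (T A)"
    "\<And>A x. A \<in> sets (Omega m) \<Longrightarrow> cinner x (T A x) = complex_of_real (G x A)" by metis
  have T_cyl: "T (cylinder m w) = F w" if "w \<in> lists {..<m}" for w
    by (rule bounded_clinear_eqI) (use T F F_G that in auto)
  show ?thesis by (rule that[OF T G_dom G_sums T_cyl])
qed

text \<open>Adding to \<open>E\<close> an operator-valued measure of total mass zero whose forms are dominated by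
  those of \<open>E\<close> gives another POVM. The weak countable additivity of \<open>T\<close> follows from that of its
  quadratic forms by polarization.\<close>

lemma POVM_perturbation:
  assumes E: "E \<in> POVMs M"
    and T: "\<And>A. A \<in> sets M \<Longrightarrow> bounded_clinear (T A)"
    and form: "\<And>A x. A \<in> sets M \<Longrightarrow> cinner x (T A x) = complex_of_real (G x A)"
    and dom: "\<And>A x. A \<in> sets M \<Longrightarrow> \<bar>G x A\<bar> \<le> Re (cinner x (E A x))"
    and sums: "\<And>A x. disjoint_family A \<Longrightarrow> range A \<subseteq> sets M \<Longrightarrow>
      (\<lambda>n::nat. G x (A n)) sums G x (\<Union>n. A n)"
    and space: "\<And>x. G x (space M) = 0"
  shows "(\<lambda>A x. E A x + T A x) \<in> POVMs M"
  unfolding POVMs_def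
proof (intro CollectI conjI ballI allI impI)
  fix A assume A: "A \<in> sets M"
  have "cinner x (E A x + T A x) = complex_of_real (Re (cinner x (E A x)) + G x A)" for x
    using positive_op_real[OF POVM_positive[OF E A], of x] by (simp add: cinner_add_right form A)
  then have "cinner x (E A x + T A x) \<in> \<real>\<^sub>\<ge>\<^sub>0" for x
    using dom[OF A, of x] by (simp add: complex_nonneg_Reals_iff)
  then show "positive_op (\<lambda>x. E A x + T A x)"
    unfolding positive_op_def
    by (intro conjI allI bounded_clinear_add T positive_op_bounded_clinear POVM_positive[OF E] A)
next
  fix A :: "nat \<Rightarrow> _" and x y
  assume "range A \<subseteq> sets M \<and> disjoint_family A"
  then have A: "disjoint_family A" "range A \<subseteq> sets M" and An: "\<And>n. A n \<in> sets M"
    and AU: "(\<Union>n. A n) \<in> sets M" by auto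
  have pol: "cinner x (T B y) =
    (complex_of_real (G (x + y) B) - complex_of_real (G (x - y) B)
     - \<i> * complex_of_real (G (x + \<i> *\<^sub>C y) B) + \<i> * complex_of_real (G (x - \<i> *\<^sub>C y) B)) / 4"
    if "B \<in> sets M" for B
    using polarization[OF T[OF that], of x y] by (simp only: form that)
  have "(\<lambda>n. cinner x (T (A n) y)) sums cinner x (T (\<Union>n. A n) y)"
    unfolding pol[OF An] pol[OF AU]
    by (intro sums_divide sums_add sums_diff sums_mult sums_of_real sums A)
  then show "(\<lambda>n. cinner x (E (A n) y + T (A n) y)) sums
      cinner x (E (\<Union>n. A n) y + T (\<Union>n. A n) y)"
    unfolding cinner_add_right by (intro sums_add POVM_sums[OF E] A)
next
  have "T (space M) = (\<lambda>x. 0)"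
    by (rule bounded_clinear_eqI) (auto intro: T bounded_clinear_zero simp: form space cinner.zero_right)
  then show "(\<lambda>x. E (space M) x + T (space M) x) = id" by (simp add: POVM_space[OF E] id_def)
qed

section \<open>Compressions to the closure of a range\<close>

lemma norm_le_of_closure_range:
  assumes z: "z \<in> closure (range S)" and bd: "\<And>k. cmod (cinner z (S k)) \<le> c * norm (S k)"
    and c: "c \<ge> 0"
  shows "norm z \<le> c"
proof -
  obtain k where k: "(\<lambda>n. S (k n)) \<longlonglongrightarrow> z" using closure_range_sequence z .
  have "cmod (cinner z z) \<le> c * norm z"
    by (rule LIMSEQ_le[OF tendsto_norm[OF cinner.tendsto[OF tendsto_const k]]
          tendsto_mult_left[OF tendsto_norm[OF k]]]) (use bd in blast)
  then have "norm z * norm z \<le> c * norm z" by (simp add: cinner_self norm_mult power2_eq_square)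
  then show ?thesis using c by (cases "z = 0") auto
qed

lemma zero_on_closure_range:
  assumes S: "bounded_clinear S" and X: "bounded_clinear_on (closure (range S)) (closure (range S)) X"
    and zero: "\<And>h k. cinner (X (S h)) (S k) = 0" and x: "x \<in> closure (range S)"
  shows "X x = 0"
proof -
  have *: "X (S h) = 0" for h
    using orthogonal_range_eq_0[OF bounded_clinear_onD(1)[OF X in_closure_range] zero] .
  obtain h where h: "(\<lambda>n. S (h n)) \<longlonglongrightarrow> x" using closure_range_sequence x .
  have "(\<lambda>n. X (S (h n))) \<longlonglongrightarrow> X x"
    by (rule bounded_clinear_on_tendsto[OF X csubspace_closure_range[OF S] in_closure_range x h])
  then show ?thesis by (simp add: * LIMSEQ_const_iff)
qed

text \<open>A self-adjoint \<open>D\<close> whose form is dominated by \<open>\<parallel>S h\<parallel> \<parallel>S k\<parallel>\<close> has the form \<open>S\<^sup>* X S\<close> for a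
  bounded self-adjoint \<open>X\<close> on the closure of the range of \<open>S\<close>.\<close>

lemma compression_exists:
  fixes S D :: "'a::complex_hilbert_space \<Rightarrow> 'a"
  assumes S: "bounded_clinear S" and D: "bounded_clinear D"
    and sym: "\<And>h k. cinner (D h) k = cinner h (D k)"
    and dom: "\<And>h k. cmod (cinner (D h) k) \<le> c * norm (S h) * norm (S k)" and c: "c \<ge> 0"
  obtains X where "selfadjoint_on (closure (range S)) X"
    "\<And>x. x \<in> closure (range S) \<Longrightarrow> norm (X x) \<le> c * norm x"
    "\<And>h k. cinner (X (S h)) (S k) = cinner (D h) k"
proof -
  let ?H = "closure (range S)"
  have H: "csubspace ?H" by (rule csubspace_closure_range) fact
  note Dlin = bounded_clinear_onD(2,3)[OF D, simplified]
  note Slin = bounded_clinear_onD(2,3)[OF S, simplified]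
  have "\<exists>z\<in>?H. \<forall>k. cinner (D h) k = cinner z (S k)" for h
  proof -
    obtain z where "z \<in> closure (S ` UNIV)" "\<And>k. k \<in> UNIV \<Longrightarrow> cinner (D h) k = cinner z (S k)"
    proof (rule Riesz_seminorm[of UNIV S "cinner (D h)" "c * norm (S h)"])
      show "cmod (cinner (D h) k) \<le> c * norm (S h) * norm (S k)" for k by (rule dom)
    qed (auto simp: Slin cinner_add_right cinner_scaleC_right)
    then show ?thesis by blast
  qed
  then obtain R where RH: "\<And>h. R h \<in> ?H" and R: "\<And>h k. cinner (R h) (S k) = cinner (D h) k"
    by metis
  have R_norm: "norm (R h) \<le> c * norm (S h)" for h
    by (rule norm_le_of_closure_range[OF RH]) (use dom R c in auto)
  have R_eqI: "R h = u" if "u \<in> ?H" "\<And>k. cinner u (S k) = cinner (D h) k" for h u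
  proof -
    have "R h - u = 0"
      by (rule orthogonal_range_eq_0[of _ S])
        (use that RH H in \<open>auto simp: csubspaceD cinner.diff_left R\<close>)
    then show ?thesis by simp
  qed
  have R_bc: "bounded_clinear R"
  proof -
    obtain K where K: "\<And>x. norm (S x) \<le> K * norm x"
      using S unfolding bounded_clinear_on_def by blast
    show ?thesis
      unfolding bounded_clinear_on_def
    proof (intro conjI ballI allI exI[of _ "c * K"])
      show "R (x + y) = R x + R y" for x y
        by (rule R_eqI) (use RH H in \<open>auto simp: csubspaceD cinner_add_left R Dlin\<close>)
      show "R (a *\<^sub>C x) = a *\<^sub>C R x" for a x
        by (rule R_eqI) (use RH H in \<open>auto simp: csubspaceD cinner_scaleC_left R Dlin\<close>)
      show "norm (R x) \<le> c * K * norm x" for x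
        using R_norm[of x] mult_left_mono[OF K[of x] c] by (simp add: mult.assoc)
    qed simp
  qed
  obtain X where X: "bounded_clinear_on ?H ?H X" "\<And>h. X (S h) = R h"
    "\<And>x. x \<in> ?H \<Longrightarrow> norm (X x) \<le> c * norm x"
  proof (rule factor_through_range[OF S R_bc R_norm, of ?H])
    show "range R \<subseteq> ?H" using RH by blast
  qed auto
  have "cinner (X x) y = cinner x (X y)" if xy: "x \<in> ?H" "y \<in> ?H" for x y
  proof -
    obtain h where h: "(\<lambda>n. S (h n)) \<longlonglongrightarrow> x" using closure_range_sequence xy(1) .
    obtain k where k: "(\<lambda>n. S (k n)) \<longlonglongrightarrow> y" using closure_range_sequence xy(2) .
    have Xh: "(\<lambda>n. X (S (h n))) \<longlonglongrightarrow> X x" and Xk: "(\<lambda>n. X (S (k n))) \<longlonglongrightarrow> X y"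
      using bounded_clinear_on_tendsto[OF X(1) H in_closure_range] xy h k by blast+
    have "cinner (X (S (h n))) (S (k n)) = cinner (S (h n)) (X (S (k n)))" for n
      using R[of "k n" "h n"] sym[of "h n" "k n"] by (metis R X(2) cinner_commute)
    then have "(\<lambda>n. cinner (X (S (h n))) (S (k n))) \<longlonglongrightarrow> cinner x (X y)"
      by (simp only: cinner.tendsto h Xk)
    then show ?thesis using cinner.tendsto[OF Xh k] LIMSEQ_unique by blast
  qed
  then have "selfadjoint_on ?H X" using X(1) by (simp add: selfadjoint_on_def)
  with X R that show ?thesis by simp
qed

section \<open>The spaces and contractions of a POVM\<close>

context
  fixes m :: nat and E :: "(nat \<Rightarrow> nat) set \<Rightarrow> 'h::complex_hilbert_space \<Rightarrow> 'h"
  assumes E: "E \<in> POVMs (Omega m)"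
begin

lemma positive_op_sqrt_cyl: "positive_op (sqrt_cyl m E w)"
  and sqrt_cyl_square: "sqrt_cyl m E w (sqrt_cyl m E w x) = E (cylinder m w) x"
  unfolding sqrt_cyl_def using POVM_positive[OF E] POVM_le[OF E]
  by (intro positive_op_sqrt_op sqrt_op_square; simp)+

lemma bounded_clinear_sqrt_cyl: "bounded_clinear (sqrt_cyl m E w)"
  by (rule positive_op_bounded_clinear) (rule positive_op_sqrt_cyl)

lemma cinner_sqrt_cyl: "cinner (sqrt_cyl m E w x) (sqrt_cyl m E w y) = cinner x (E (cylinder m w) y)"
  by (simp add: positive_op_selfadjoint[OF positive_op_sqrt_cyl] sqrt_cyl_square)

lemma norm_sqrt_cyl_sq: "(norm (sqrt_cyl m E w x))\<^sup>2 = Re (cinner x (E (cylinder m w) x))"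
  by (simp flip: cinner_sqrt_cyl) (simp add: cinner_self)

lemma norm_sqrt_cyl_le: "norm (sqrt_cyl m E w x) \<le> norm x"
  by (rule power2_le_imp_le) (simp_all add: norm_sqrt_cyl_sq POVM_le[OF E])

lemma range_space:
  shows csubspace_range_space: "csubspace (range_space m E w)"
    and closed_range_space: "closed (range_space m E w)"
    and sqrt_cyl_in_range_space: "sqrt_cyl m E w h \<in> range_space m E w"
  unfolding range_space_def
  by (simp_all add: csubspace_closure_range bounded_clinear_sqrt_cyl)

lemma norm_sqrt_cyl_snoc: "norm (sqrt_cyl m E (w @ [j]) h) \<le> norm (sqrt_cyl m E w h)"
proof (rule power2_le_imp_le)
  interpret finite_measure "povm_measure (Omega m) E h"
    by (rule finite_measure_povm_measure) (rule E)
  have "measure (povm_measure (Omega m) E h) (cylinder m (w @ [j])) \<le>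
      measure (povm_measure (Omega m) E h) (cylinder m w)"
    by (rule finite_measure_mono) (auto simp: mem_cylinder_snoc sets_povm_measure)
  then show "(norm (sqrt_cyl m E (w @ [j]) h))\<^sup>2 \<le> (norm (sqrt_cyl m E w h))\<^sup>2"
    by (simp add: norm_sqrt_cyl_sq measure_povm_measure[OF E])
qed simp

lemma edge_contraction:
  shows edge_contraction_bounded_clinear_on:
      "bounded_clinear_on (range_space m E w) (range_space m E (w @ [j])) (edge_contraction m E w j)"
    and edge_contraction_sqrt_cyl:
      "edge_contraction m E w j (sqrt_cyl m E w h) = sqrt_cyl m E (w @ [j]) h"
proof -
  let ?H = "range_space m E w" and ?K = "range_space m E (w @ [j])"
  let ?P = "\<lambda>C. C \<in> extensional ?H \<and> bounded_clinear_on ?H ?K C \<and>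
     (\<forall>x\<in>?H. norm (C x) \<le> norm x) \<and> (\<forall>h. C (sqrt_cyl m E w h) = sqrt_cyl m E (w @ [j]) h)"
  have ex1: "\<exists>!C. ?P C"
  proof (rule ex_ex1I)
    obtain C where C: "bounded_clinear_on ?H ?K C" "\<And>h. C (sqrt_cyl m E w h) = sqrt_cyl m E (w @ [j]) h"
      "\<And>x. x \<in> ?H \<Longrightarrow> norm (C x) \<le> 1 * norm x"
      unfolding range_space_def
    proof (rule factor_through_range[OF bounded_clinear_sqrt_cyl[of w]
          bounded_clinear_sqrt_cyl[of "w @ [j]"], of 1 "closure (range (sqrt_cyl m E (w @ [j])))"])
      show "norm (sqrt_cyl m E (w @ [j]) h) \<le> 1 * norm (sqrt_cyl m E w h)" for h
        using norm_sqrt_cyl_snoc by simp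
      show "range (sqrt_cyl m E (w @ [j])) \<subseteq> closure (range (sqrt_cyl m E (w @ [j])))"
        by (rule closure_subset)
    qed auto
    have "bounded_clinear_on ?H ?K (restrict C ?H)"
      using C(1) csubspaceD[OF csubspace_range_space[of w]]
      unfolding bounded_clinear_on_def by (auto simp: Pi_iff)
    with C show "\<exists>C. ?P C"
      by (intro exI[of _ "restrict C ?H"]) (simp add: sqrt_cyl_in_range_space)
  next
    fix C C' assume C: "?P C" and C': "?P C'"
    show "C = C'"
    proof (rule extensionalityI[of _ ?H])
      fix x assume x: "x \<in> ?H"
      then obtain h where h: "(\<lambda>n. sqrt_cyl m E w (h n)) \<longlonglongrightarrow> x"
        unfolding range_space_def by (rule closure_range_sequence)
      have lim: "(\<lambda>n. B (sqrt_cyl m E w (h n))) \<longlonglongrightarrow> B x" if "bounded_clinear_on ?H ?K B" for B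
        by (rule bounded_clinear_on_tendsto[OF that csubspace_range_space sqrt_cyl_in_range_space x h])
      have "(\<lambda>n. sqrt_cyl m E (w @ [j]) (h n)) \<longlonglongrightarrow> C x"
        "(\<lambda>n. sqrt_cyl m E (w @ [j]) (h n)) \<longlonglongrightarrow> C' x"
        using lim[of C] lim[of C'] C C' by simp_all
      then show "C x = C' x" by (rule LIMSEQ_unique)
    qed (use C C' in auto)
  qed
  have "?P (edge_contraction m E w j)"
    unfolding edge_contraction_def by (rule theI'[OF ex1])
  then show "bounded_clinear_on ?H ?K (edge_contraction m E w j)"
    "edge_contraction m E w j (sqrt_cyl m E w h) = sqrt_cyl m E (w @ [j]) h" by blast+
qed

lemma POVM_cylinder_snoc: "E (cylinder m w) = (\<lambda>x. \<Sum>j<m. E (cylinder m (w @ [j])) x)"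
proof (rule bounded_clinear_eqI)
  show "bounded_clinear (E (cylinder m w))"
    "bounded_clinear (\<lambda>x. \<Sum>j<m. E (cylinder m (w @ [j])) x)"
    by (intro bounded_clinear_sum positive_op_bounded_clinear POVM_positive[OF E] cylinder_measurable)+
  fix x
  interpret finite_measure "povm_measure (Omega m) E x"
    by (rule finite_measure_povm_measure) (rule E)
  have "measure (povm_measure (Omega m) E x) (\<Union>j<m. cylinder m (w @ [j])) =
      (\<Sum>j<m. measure (povm_measure (Omega m) E x) (cylinder m (w @ [j])))"
    by (rule finite_measure_finite_Union) (auto simp: sets_povm_measure cylinder_snoc(2))
  then have "Re (cinner x (E (cylinder m w) x)) = (\<Sum>j<m. Re (cinner x (E (cylinder m (w @ [j])) x)))"
    by (simp add: measure_povm_measure[OF E] flip: cylinder_snoc(1))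
  moreover have "cinner x (E (cylinder m v) x) = complex_of_real (Re (cinner x (E (cylinder m v) x)))" for v
    by (rule positive_op_real) (simp add: POVM_positive[OF E])
  ultimately show "cinner x (E (cylinder m w) x) = cinner x (\<Sum>j<m. E (cylinder m (w @ [j])) x)"
    unfolding cinner.sum_right by (simp add: complex_eq_iff)
qed

text \<open>The sum in the martingale identity, without adjoints: tested against a vector of \<open>H\<^sub>w\<close> it is
  a sum of forms on the spaces \<open>H\<^sub>w\<^sub>j\<close>.\<close>

lemma cinner_edge_sum:
  assumes X: "\<And>j. j < m \<Longrightarrow> bounded_clinear_on (range_space m E (w @ [j])) (range_space m E (w @ [j])) (X (w @ [j]))"
    and x: "x \<in> range_space m E w" and y: "y \<in> range_space m E w"
  shows "cinner (\<Sum>j<m. adjoint_on (range_space m E w) (range_space m E (w @ [j]))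
      (edge_contraction m E w j) (X (w @ [j]) (edge_contraction m E w j x))) y =
    (\<Sum>j<m. cinner (X (w @ [j]) (edge_contraction m E w j x)) (edge_contraction m E w j y))"
  unfolding cinner.sum_left
proof (rule sum.cong)
  fix j assume "j \<in> {..<m}"
  then have "X (w @ [j]) (edge_contraction m E w j x) \<in> range_space m E (w @ [j])"
    using X bounded_clinear_onD(1) edge_contraction_bounded_clinear_on x by blast
  then show "cinner (adjoint_on (range_space m E w) (range_space m E (w @ [j]))
      (edge_contraction m E w j) (X (w @ [j]) (edge_contraction m E w j x))) y =
      cinner (X (w @ [j]) (edge_contraction m E w j x)) (edge_contraction m E w j y)"
    using cinner_adjoint_on[OF csubspace_range_space closed_range_space
        edge_contraction_bounded_clinear_on] y by blast
qed simp

text \<open>The forms \<open>(h, k) \<mapsto> \<langle>X\<^sub>w E\<^sub>w\<^sup>1\<^sup>/\<^sup>2 h, E\<^sub>w\<^sup>1\<^sup>/\<^sup>2 k\<rangle>\<close> are additive in \<open>w\<close>.\<close>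

lemma martingale_cinner_sqrt_cyl:
  assumes "bounded_range_martingale m E X" and w: "w \<in> lists {..<m}"
  shows "cinner (X w (sqrt_cyl m E w h)) (sqrt_cyl m E w k) =
    (\<Sum>j<m. cinner (X (w @ [j]) (sqrt_cyl m E (w @ [j]) h)) (sqrt_cyl m E (w @ [j]) k))"
proof -
  have X: "bounded_clinear_on (range_space m E v) (range_space m E v) (X v)" if "v \<in> lists {..<m}" for v
    using assms(1) that by (auto simp: bounded_range_martingale_def selfadjoint_on_def)
  have id: "X w x = (\<Sum>j<m. adjoint_on (range_space m E w) (range_space m E (w @ [j]))
      (edge_contraction m E w j) (X (w @ [j]) (edge_contraction m E w j x)))"
    if "x \<in> range_space m E w" for x
    using assms that by (simp add: bounded_range_martingale_def)
  show ?thesis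
    unfolding id[OF sqrt_cyl_in_range_space]
    by (subst cinner_edge_sum) (use X w in \<open>auto simp: sqrt_cyl_in_range_space edge_contraction_sqrt_cyl\<close>)
qed

lemma martingale_bound:
  assumes "bounded_range_martingale m E X"
  obtains c where "c \<ge> 0"
    "\<And>w x. w \<in> lists {..<m} \<Longrightarrow> x \<in> range_space m E w \<Longrightarrow> norm (X w x) \<le> c * norm x"
proof -
  obtain b where b: "\<And>w. w \<in> lists {..<m} \<Longrightarrow> onorm_on (range_space m E w) (X w) \<le> b"
    using assms unfolding bounded_range_martingale_def bdd_above_def by blast
  have "norm (X w x) \<le> max b 0 * norm x" if w: "w \<in> lists {..<m}" and x: "x \<in> range_space m E w" for w x
  proof -
    have X: "bounded_clinear_on (range_space m E w) (range_space m E w) (X w)"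
      using assms w by (auto simp: bounded_range_martingale_def selfadjoint_on_def)
    then obtain K where K: "\<And>x. x \<in> range_space m E w \<Longrightarrow> norm (X w x) \<le> K * norm x"
      unfolding bounded_clinear_on_def by blast
    have "bdd_above ((\<lambda>x. norm (X w x) / norm x) ` range_space m E w)"
    proof (rule bdd_aboveI2)
      fix x assume x: "x \<in> range_space m E w"
      have "norm (X w x) \<le> \<bar>K\<bar> * norm x"
        using K[OF x] mult_right_mono[OF abs_ge_self norm_ge_zero, of K x] by linarith
      then show "norm (X w x) / norm x \<le> \<bar>K\<bar>" by (cases "x = 0") (simp_all add: divide_le_eq)
    qed
    then have "norm (X w x) / norm x \<le> onorm_on (range_space m E w) (X w)"
      unfolding onorm_on_def by (rule cSUP_upper[OF x])
    then have *: "norm (X w x) / norm x \<le> max b 0" using b[OF w] by simp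
    show ?thesis
    proof (cases "x = 0")
      case True
      then show ?thesis using K[OF x] by simp
    next
      case False
      then show ?thesis using * by (simp add: divide_le_eq)
    qed
  qed
  then show ?thesis by (intro that[of "max b 0"]) auto
qed

end

section \<open>From martingales to perturbations of the POVM\<close>

text \<open>For a bounded martingale \<open>X\<close> that vanishes at the empty word, the operators
  \<open>t E\<^sub>w\<^sup>1\<^sup>/\<^sup>2 X\<^sub>w E\<^sub>w\<^sup>1\<^sup>/\<^sup>2\<close> extend to an operator-valued measure \<open>T\<close> of total mass zero, and \<open>E\<close> is
  the midpoint of \<open>E + T\<close> and \<open>E - T\<close>.\<close>

lemma extreme_imp_martingale_zero:
  fixes E :: "(nat \<Rightarrow> nat) set \<Rightarrow> 'h::complex_hilbert_space \<Rightarrow> 'h"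
  assumes ext: "extreme_POVM (Omega m) E"
    and X: "bounded_range_martingale m E X" and X0: "\<And>x. x \<in> range_space m E [] \<Longrightarrow> X [] x = 0"
    and w: "w \<in> lists {..<m}" and x: "x \<in> range_space m E w"
  shows "X w x = 0"
proof -
  have E: "E \<in> POVMs (Omega m)" using ext by (simp add: extreme_POVM_def)
  let ?S = "sqrt_cyl m E"
  obtain c where c: "c \<ge> 0"
    and Xb: "\<And>w x. w \<in> lists {..<m} \<Longrightarrow> x \<in> range_space m E w \<Longrightarrow> norm (X w x) \<le> c * norm x"
    using martingale_bound[OF E X] by blast
  have Xsa: "selfadjoint_on (range_space m E w) (X w)" if "w \<in> lists {..<m}" for w
    using X that by (simp add: bounded_range_martingale_def)
  then have Xbc: "bounded_clinear_on (range_space m E w) (range_space m E w) (X w)"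
    if "w \<in> lists {..<m}" for w using that by (simp add: selfadjoint_on_def)
  \<comment> \<open>The factor \<open>t\<close> makes the forms of \<open>F w\<close> dominated by those of \<open>E ([w])\<close>.\<close>
  define t where "t = 1 / (c + 1)"
  have t: "t > 0" "t * c \<le> 1" using c by (simp_all add: t_def)
  define F where "F w x = t *\<^sub>R ?S w (X w (?S w x))" for w x
  have F_form: "cinner x (F w y) = of_real t * cinner (?S w x) (X w (?S w y))" for w x y
    by (simp add: F_def cinner_scaleR_right positive_op_selfadjoint[OF positive_op_sqrt_cyl[OF E]])
  have F_bc: "bounded_clinear (F w)" if w: "w \<in> lists {..<m}" for w
  proof -
    note Slin = bounded_clinear_onD(2,3)[OF bounded_clinear_sqrt_cyl[OF E], simplified]
    have "bounded_clinear (\<lambda>x. ?S w (X w (?S w x)))"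
      unfolding bounded_clinear_on_def
    proof (intro conjI ballI allI exI[of _ c])
      show "norm (?S w (X w (?S w x))) \<le> c * norm x" for x
      proof -
        have "norm (?S w (X w (?S w x))) \<le> norm (X w (?S w x))"
          by (rule norm_sqrt_cyl_le[OF E])
        also have "\<dots> \<le> c * norm (?S w x)" by (rule Xb[OF w sqrt_cyl_in_range_space[OF E]])
        also have "\<dots> \<le> c * norm x" using c by (intro mult_left_mono norm_sqrt_cyl_le[OF E])
        finally show ?thesis .
      qed
    qed (simp_all add: Slin bounded_clinear_onD(2,3)[OF Xbc[OF w]] sqrt_cyl_in_range_space[OF E])
    then show ?thesis unfolding F_def [abs_def] by (rule bounded_clinear_scaleR)
  qed
  have XS_sym: "cinner (?S w x) (X w (?S w y)) = cinner (X w (?S w x)) (?S w y)"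
    if "w \<in> lists {..<m}" for w x y
    using Xsa[OF that] sqrt_cyl_in_range_space[OF E] by (simp add: selfadjoint_on_def)
  have F_real: "cinner x (F w x) \<in> \<real>" if w: "w \<in> lists {..<m}" for w x
  proof -
    have "cnj (cinner (?S w x) (X w (?S w x))) = cinner (?S w x) (X w (?S w x))"
      using XS_sym[OF w, of x x] by (metis cinner_commute)
    then show ?thesis unfolding F_form by (simp add: Reals_cnj_iff)
  qed
  have F_add: "cinner x (F w x) = (\<Sum>j<m. cinner x (F (w @ [j]) x))" if w: "w \<in> lists {..<m}" for w x
  proof -
    have "cinner x (F w x) = of_real t * (\<Sum>j<m. cinner (X (w @ [j]) (?S (w @ [j]) x)) (?S (w @ [j]) x))"
      unfolding F_form XS_sym[OF w] martingale_cinner_sqrt_cyl[OF E X w] ..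
    also have "\<dots> = (\<Sum>j<m. cinner x (F (w @ [j]) x))"
      unfolding F_form sum_distrib_left by (intro sum.cong) (use w XS_sym in auto)
    finally show ?thesis .
  qed
  have F_dom: "\<bar>Re (cinner x (F w x))\<bar> \<le> Re (cinner x (E (cylinder m w) x))"
    if w: "w \<in> lists {..<m}" for w x
  proof -
    have "\<bar>Re (cinner x (F w x))\<bar> = t * \<bar>Re (cinner (?S w x) (X w (?S w x)))\<bar>"
      using t by (simp add: F_form abs_mult)
    also have "\<dots> \<le> t * (norm (?S w x) * norm (X w (?S w x)))"
      using t abs_Re_le_cmod Cauchy_Schwarz order_trans by (intro mult_left_mono) (blast, simp)
    also have "\<dots> \<le> t * (norm (?S w x) * (c * norm (?S w x)))"
      using t by (intro mult_left_mono Xb[OF w sqrt_cyl_in_range_space[OF E]]) auto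
    also have "\<dots> = (t * c) * (norm (?S w x))\<^sup>2" by (simp add: power2_eq_square)
    also have "\<dots> \<le> (norm (?S w x))\<^sup>2" using t c by (intro mult_left_le_one_le) auto
    finally show ?thesis by (simp add: norm_sqrt_cyl_sq[OF E])
  qed
  obtain T G where T: "\<And>A. A \<in> sets (Omega m) \<Longrightarrow> bounded_clinear (T A)"
    and form: "\<And>A x. A \<in> sets (Omega m) \<Longrightarrow> cinner x (T A x) = complex_of_real (G x A)"
    and dom: "\<And>A x. A \<in> sets (Omega m) \<Longrightarrow> \<bar>G x A\<bar> \<le> Re (cinner x (E A x))"
    and sums: "\<And>A x. disjoint_family A \<Longrightarrow> range A \<subseteq> sets (Omega m) \<Longrightarrow>
      (\<lambda>n::nat. G x (A n)) sums G x (\<Union>n. A n)"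
    and T_cyl: "\<And>w. w \<in> lists {..<m} \<Longrightarrow> T (cylinder m w) = F w"
    by (rule operator_measure_extension[OF E F_bc F_real F_add F_dom]) (assumption | rule that)+
  have G0: "G x (space (Omega m)) = 0" for x
  proof -
    have "complex_of_real (G x (space (Omega m))) = cinner x (F [] x)"
      using form[of "cylinder m []" x] T_cyl[of "[]"] by (simp add: cylinder_Nil)
    also have "\<dots> = 0"
      by (simp add: F_form X0 sqrt_cyl_in_range_space[OF E] cinner.zero_right)
    finally show ?thesis by simp
  qed
  have E1: "(\<lambda>A x. E A x + T A x) \<in> POVMs (Omega m)"
    by (rule POVM_perturbation[OF E T form dom sums G0])
  have E2: "(\<lambda>A x. E A x + - T A x) \<in> POVMs (Omega m)"
  proof (rule POVM_perturbation[OF E, where G = "\<lambda>x A. - G x A"])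
    show "bounded_clinear (\<lambda>x. - T A x)" if "A \<in> sets (Omega m)" for A
      using bounded_clinear_scaleR[OF T[OF that], of "-1"] by simp
    show "(\<lambda>n. - G x (A n)) sums - G x (\<Union>n. A n)"
      if "disjoint_family A" "range A \<subseteq> sets (Omega m)" for A :: "nat \<Rightarrow> _" and x
      by (rule sums_minus) (rule sums[OF that])
  qed (use form dom G0 in \<open>auto simp: cinner.minus_right\<close>)
  have "(\<lambda>x. E A x + T A x) = E A" if A: "A \<in> sets (Omega m)" for A
  proof -
    have mean: "\<forall>A\<in>sets (Omega m). \<forall>x. E A x = (1/2) *\<^sub>R ((E A x + T A x) + (E A x + - T A x))"
      by (simp flip: scaleR_2)
    show ?thesis
      using ext[unfolded extreme_POVM_def, THEN conjunct2, THEN bspec, OF E1, THEN bspec, OF E2,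
          THEN mp, OF mean] A by blast
  qed
  then have "T A x = 0" if "A \<in> sets (Omega m)" for A x
    using that by (metis add_cancel_right_right)
  then have "F w x = 0" for x using T_cyl[OF w] by (metis cylinder_measurable)
  then have "cinner (X w (?S w h)) (?S w k) = 0" for h k
    using F_form[of h w k] t XS_sym[OF w, of h k] by (simp add: cinner.zero_right)
  then show ?thesis
    using zero_on_closure_range[OF bounded_clinear_sqrt_cyl[OF E], of w "X w" x] Xbc[OF w] x
    by (simp add: range_space_def)
qed

section \<open>From decompositions of the POVM to martingales\<close>

lemma POVM_eqI:
  assumes E: "E \<in> POVMs (Omega m)" and E': "E' \<in> POVMs (Omega m)"
    and eq: "\<And>w. w \<in> lists {..<m} \<Longrightarrow> E' (cylinder m w) = E (cylinder m w)"
    and A: "A \<in> sets (Omega m)"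
  shows "E' A = E A"
proof (rule bounded_clinear_eqI)
  fix x
  interpret M: finite_measure "povm_measure (Omega m) E x"
    by (rule finite_measure_povm_measure) fact
  interpret M': finite_measure "povm_measure (Omega m) E' x"
    by (rule finite_measure_povm_measure) fact
  let ?M = "measure (povm_measure (Omega m) E x)" and ?M' = "measure (povm_measure (Omega m) E' x)"
  have "?M' A = ?M A"
    using A
  proof (induction rule: sets_Omega_induct)
    case (cylinder w)
    then show ?case by (simp add: measure_povm_measure E E' eq)
  next
    case (compl A)
    have "?M' (space (Omega m)) = ?M (space (Omega m))"
      by (simp add: measure_povm_measure E E' POVM_space[OF E] POVM_space[OF E'])
    then show ?case
      using compl M.finite_measure_compl[of A] M'.finite_measure_compl[of A]
      by (simp add: space_povm_measure sets_povm_measure)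
  next
    case (union A)
    have "(\<lambda>i. ?M (A i)) sums ?M (\<Union>i. A i)" "(\<lambda>i. ?M' (A i)) sums ?M' (\<Union>i. A i)"
      using union(1,2)
      by (intro M.finite_measure_UNION M'.finite_measure_UNION; simp add: sets_povm_measure)+
    then show ?case using union(3) by (simp add: sums_iff)
  qed simp
  then have "Re (cinner x (E' A x)) = Re (cinner x (E A x))"
    by (simp add: measure_povm_measure E E' A)
  then show "cinner x (E' A x) = cinner x (E A x)"
    by (metis positive_op_real POVM_positive[OF E A] POVM_positive[OF E' A])
qed (use POVM_positive[OF E A] POVM_positive[OF E' A] positive_op_bounded_clinear in auto)

text \<open>A POVM \<open>E' \<le> 2 E\<close> differs from \<open>E\<close> on cylinders by \<open>E\<^sub>w\<^sup>1\<^sup>/\<^sup>2 X\<^sub>w E\<^sub>w\<^sup>1\<^sup>/\<^sup>2\<close> for a bounded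
  martingale \<open>X\<close> that vanishes at the empty word. The bound \<open>\<parallel>X\<^sub>w\<parallel> \<le> 3\<close> has the contributions \<open>2\<close> of
  \<open>E'\<close> and \<open>1\<close> of \<open>E\<close>.\<close>

lemma martingale_zero_imp_eq:
  fixes E :: "(nat \<Rightarrow> nat) set \<Rightarrow> 'h::complex_hilbert_space \<Rightarrow> 'h"
  assumes E: "E \<in> POVMs (Omega m)" and E': "E' \<in> POVMs (Omega m)"
    and le: "\<And>A x. A \<in> sets (Omega m) \<Longrightarrow> Re (cinner x (E' A x)) \<le> 2 * Re (cinner x (E A x))"
    and zero: "\<And>X. bounded_range_martingale m E X \<Longrightarrow> \<forall>x\<in>range_space m E []. X [] x = 0 \<Longrightarrow>
      \<forall>w\<in>lists {..<m}. \<forall>x\<in>range_space m E w. X w x = 0"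
    and A: "A \<in> sets (Omega m)"
  shows "E' A = E A"
proof (rule POVM_eqI[OF E E' _ A])
  let ?S = "sqrt_cyl m E"
  define D where "D w x = E' (cylinder m w) x - E (cylinder m w) x" for w x
  have pos: "positive_op (E (cylinder m w))" "positive_op (E' (cylinder m w))" for w
    by (intro POVM_positive[OF E] POVM_positive[OF E'] cylinder_measurable)+
  have D_bc: "bounded_clinear (D w)" for w
    unfolding D_def [abs_def] by (intro bounded_clinear_diff positive_op_bounded_clinear pos)
  have D_sym: "cinner (D w h) k = cinner h (D w k)" for w h k
    by (simp add: D_def cinner.diff_left cinner.diff_right positive_op_selfadjoint[OF pos(1)]
        positive_op_selfadjoint[OF pos(2)])
  have D_dom: "cmod (cinner (D w h) k) \<le> 3 * norm (?S w h) * norm (?S w k)" for w h k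
  proof -
    have "cmod (cinner h (E (cylinder m w) k)) \<le> norm (?S w h) * norm (?S w k)"
      unfolding cinner_sqrt_cyl[OF E, symmetric] by (rule Cauchy_Schwarz)
    moreover have "cmod (cinner h (E' (cylinder m w) k)) \<le> 2 * (norm (?S w h) * norm (?S w k))"
    proof (rule power2_le_imp_le)
      have "(cmod (cinner h (E' (cylinder m w) k)))\<^sup>2 \<le>
          Re (cinner h (E' (cylinder m w) h)) * Re (cinner k (E' (cylinder m w) k))"
        by (rule positive_op_Cauchy_Schwarz) (rule pos)
      also have "\<dots> \<le> (2 * (norm (?S w h))\<^sup>2) * (2 * (norm (?S w k))\<^sup>2)"
        unfolding norm_sqrt_cyl_sq[OF E]
        using positive_op_nonneg[OF pos(1)] by (intro mult_mono le positive_op_nonneg pos) auto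
      also have "\<dots> = (2 * (norm (?S w h) * norm (?S w k)))\<^sup>2" by (simp add: power_mult_distrib)
      finally show "(cmod (cinner h (E' (cylinder m w) k)))\<^sup>2 \<le> (2 * (norm (?S w h) * norm (?S w k)))\<^sup>2" .
    qed simp
    moreover have "cmod (cinner (D w h) k) \<le>
        cmod (cinner h (E' (cylinder m w) k)) + cmod (cinner h (E (cylinder m w) k))"
      unfolding D_sym by (simp add: D_def cinner.diff_right norm_triangle_ineq4)
    ultimately show ?thesis by (simp add: mult.assoc)
  qed
  have "\<exists>X. selfadjoint_on (range_space m E w) X \<and> (\<forall>x\<in>range_space m E w. norm (X x) \<le> 3 * norm x) \<and>
      (\<forall>h k. cinner (X (?S w h)) (?S w k) = cinner (D w h) k)" for w
    unfolding range_space_def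
    by (rule compression_exists[OF bounded_clinear_sqrt_cyl[OF E] D_bc D_sym D_dom]) auto
  then obtain X where Xsa: "\<And>w. selfadjoint_on (range_space m E w) (X w)"
    and Xb: "\<And>w x. x \<in> range_space m E w \<Longrightarrow> norm (X w x) \<le> 3 * norm x"
    and XD: "\<And>w h k. cinner (X w (?S w h)) (?S w k) = cinner (D w h) k" by metis
  have Xbc: "bounded_clinear_on (range_space m E w) (range_space m E w) (X w)" for w
    using Xsa by (simp add: selfadjoint_on_def)
  have "X w x = (\<Sum>j<m. adjoint_on (range_space m E w) (range_space m E (w @ [j]))
      (edge_contraction m E w j) (X (w @ [j]) (edge_contraction m E w j x)))" (is "_ = ?Y")
    if x: "x \<in> range_space m E w" for w x
  proof -
    let ?C = "edge_contraction m E w"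
    note C = edge_contraction_bounded_clinear_on[OF E, of w]
    note sub = csubspace_range_space[OF E] and S_in = sqrt_cyl_in_range_space[OF E]
    have "cinner (X w x) y = cinner ?Y y" if y: "y \<in> range_space m E w" for y
    proof -
      obtain h where h: "(\<lambda>n. ?S w (h n)) \<longlonglongrightarrow> x"
        using x unfolding range_space_def by (rule closure_range_sequence)
      obtain k where k: "(\<lambda>n. ?S w (k n)) \<longlonglongrightarrow> y"
        using y unfolding range_space_def by (rule closure_range_sequence)
      have Sh: "(\<lambda>n. ?S (w @ [j]) (h n)) \<longlonglongrightarrow> ?C j x" for j
        using bounded_clinear_on_tendsto[OF C sub S_in x h] by (simp add: edge_contraction_sqrt_cyl[OF E])
      have Sk: "(\<lambda>n. ?S (w @ [j]) (k n)) \<longlonglongrightarrow> ?C j y" for j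
        using bounded_clinear_on_tendsto[OF C sub S_in y k] by (simp add: edge_contraction_sqrt_cyl[OF E])
      have "(\<lambda>n. cinner (X w (?S w (h n))) (?S w (k n))) \<longlonglongrightarrow> cinner (X w x) y"
        by (intro cinner.tendsto k bounded_clinear_on_tendsto[OF Xbc sub S_in x h])
      moreover have "(\<lambda>n. \<Sum>j<m. cinner (X (w @ [j]) (?S (w @ [j]) (h n))) (?S (w @ [j]) (k n)))
          \<longlonglongrightarrow> (\<Sum>j<m. cinner (X (w @ [j]) (?C j x)) (?C j y))"
        by (intro tendsto_sum cinner.tendsto Sk
            bounded_clinear_on_tendsto[OF Xbc sub S_in bounded_clinear_onD(1)[OF C x] Sh])
      moreover have "cinner (X w (?S w h)) (?S w k) =
          (\<Sum>j<m. cinner (X (w @ [j]) (?S (w @ [j]) h)) (?S (w @ [j]) k))" for h k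
        unfolding XD cinner.sum_left[symmetric]
        unfolding D_def POVM_cylinder_snoc[OF E, of w] POVM_cylinder_snoc[OF E', of w]
        by (simp only: sum_subtractf)
      ultimately have "cinner (X w x) y = (\<Sum>j<m. cinner (X (w @ [j]) (?C j x)) (?C j y))"
        using LIMSEQ_unique by simp
      then show ?thesis using cinner_edge_sum[OF E Xbc x y] by simp
    qed
    moreover have "X w x - ?Y \<in> range_space m E w"
      by (intro csubspaceD[OF sub] csubspace_sum[OF sub] bounded_clinear_onD(1)[OF Xbc] x
          adjoint_on_mem[OF sub closed_range_space[OF E] C] bounded_clinear_onD(1)[OF C])
    ultimately have "cinner (X w x - ?Y) (X w x - ?Y) = 0" by (simp only: cinner.diff_left diff_self)
    then show ?thesis by (simp add: cinner_self_eq_zero_iff)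
  qed
  moreover have "bdd_above ((\<lambda>w. onorm_on (range_space m E w) (X w)) ` lists {..<m})"
  proof (rule bdd_aboveI2)
    fix w
    have "range_space m E w \<noteq> {}" using sqrt_cyl_in_range_space[OF E] by blast
    then show "onorm_on (range_space m E w) (X w) \<le> 3"
      unfolding onorm_on_def
    proof (rule cSUP_least)
      fix x assume "x \<in> range_space m E w"
      then show "norm (X w x) / norm x \<le> 3"
        using Xb by (cases "x = 0") (auto simp: divide_le_eq)
    qed
  qed
  ultimately have "bounded_range_martingale m E X"
    using Xsa unfolding bounded_range_martingale_def by blast
  moreover have "\<forall>x\<in>range_space m E []. X [] x = 0"
  proof
    fix x assume x: "x \<in> range_space m E []"
    have "D [] h = 0" for h
      by (simp add: D_def cylinder_Nil POVM_space[OF E] POVM_space[OF E'])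
    then have "cinner (X [] (?S [] h)) (?S [] k) = 0" for h k
      unfolding XD by (simp add: cinner.zero_left)
    then show "X [] x = 0"
      using zero_on_closure_range[OF bounded_clinear_sqrt_cyl[OF E], of "[]" "X []" x] Xbc[of "[]"] x
      by (simp add: range_space_def)
  qed
  ultimately have X0: "\<forall>w\<in>lists {..<m}. \<forall>x\<in>range_space m E w. X w x = 0" by (rule zero)
  fix w assume w: "w \<in> lists {..<m}"
  have "D w h = 0" for h
  proof (rule cinner_eqI)
    show "cinner (D w h) k = cinner 0 k" for k
      using X0 w sqrt_cyl_in_range_space[OF E] by (simp add: cinner.zero_left flip: XD)
  qed
  then show "E' (cylinder m w) = E (cylinder m w)" by (simp add: D_def fun_eq_iff)
qed

theorem theorem4p5:
  fixes m :: nat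
    and E :: "(nat \<Rightarrow> nat) set \<Rightarrow> 'h::complex_hilbert_space \<Rightarrow> 'h"
  assumes "m \<ge> 2"
    and "E \<in> POVMs (Omega m)"
  shows "extreme_POVM (Omega m) E \<longleftrightarrow>
    (\<forall>X. bounded_range_martingale m E X \<and> (\<forall>x\<in>range_space m E []. X [] x = 0) \<longrightarrow>
         (\<forall>w\<in>lists {..<m}. \<forall>x\<in>range_space m E w. X w x = 0))"
proof
  assume "extreme_POVM (Omega m) E"
  then show "\<forall>X. bounded_range_martingale m E X \<and> (\<forall>x\<in>range_space m E []. X [] x = 0) \<longrightarrow>
         (\<forall>w\<in>lists {..<m}. \<forall>x\<in>range_space m E w. X w x = 0)"
    using extreme_imp_martingale_zero by blast
next
  assume zero: "\<forall>X. bounded_range_martingale m E X \<and> (\<forall>x\<in>range_space m E []. X [] x = 0) \<longrightarrow>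
         (\<forall>w\<in>lists {..<m}. \<forall>x\<in>range_space m E w. X w x = 0)"
  show "extreme_POVM (Omega m) E"
    unfolding extreme_POVM_def
  proof (intro conjI ballI impI assms(2))
    fix E1 E2 A
    assume E1: "E1 \<in> POVMs (Omega m)" and E2: "E2 \<in> POVMs (Omega m)"
      and avg: "\<forall>A\<in>sets (Omega m). \<forall>x. E A x = (1/2) *\<^sub>R (E1 A x + E2 A x)"
      and A: "A \<in> sets (Omega m)"
    have two: "2 *\<^sub>R E B x = E1 B x + E2 B x" if "B \<in> sets (Omega m)" for B x
      using avg that by simp
    have le: "Re (cinner x (E1 B x)) \<le> 2 * Re (cinner x (E B x))"
      if B: "B \<in> sets (Omega m)" for B x
    proof -
      have "2 * Re (cinner x (E B x)) = Re (cinner x (2 *\<^sub>R E B x))"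
        by (simp add: cinner_scaleR_right)
      also have "\<dots> = Re (cinner x (E1 B x)) + Re (cinner x (E2 B x))"
        unfolding two[OF B] by (simp add: cinner_add_right)
      finally show ?thesis using positive_op_nonneg[OF POVM_positive[OF E2 B], of x] by simp
    qed
    show "E1 A = E A"
    proof (rule martingale_zero_imp_eq[OF assms(2) E1 le _ A])
      fix X assume "bounded_range_martingale m E X" "\<forall>x\<in>range_space m E []. X [] x = 0"
      then show "\<forall>w\<in>lists {..<m}. \<forall>x\<in>range_space m E w. X w x = 0"
        using zero[THEN spec[of _ X]] by simp
    qed
    then have "E2 A x = E A x" for x
      using two[OF A, of x] by (simp add: scaleR_2)
    then show "E2 A = E A" ..
  qed
qed

end
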